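(* Let $s\ge 4$ be an integer. Then, as $n\to\infty$ (with $s$ fixed), $$\mathrm{exco}_2(n,C_s^3)=\left\lfloor\frac{s-1}{2}\right\rfloor n^3(1+o(1))\quad\text{and}\quad \mathrm{exco}_2(n,P_s^3)=\left\lfloor\frac{s-1}{2}\right\rfloor n^3(1+o(1)).$$
   Context: A $3$-uniform hypergraph is $H$-free if it contains no (not necessarily induced) copy of $H$ as a subhypergraph. For a $3$-uniform hypergraph $G$ and distinct vertices $x,y$, $d_G(x,y)$ is the number of edges containing both $x$ and $y$, and $\mathrm{co}_2(G)=\sum_{\{x,y\}\in\binom{V(G)}{2}}d_G(x,y)^2$. $\mathrm{exco}_2(n,H)$ is the maximum of $\mathrm{co}_2(G)$ over all $H$-free $3$-uniform hypergraphs $G$ on $n$ vertices. The loose $s$-path $P_s^3$ is the $3$-uniform hypergraph with $s$ edges $e_1,\dots,e_s$ such that $|e_i\cap e_j|=1$ if $|i-j|=1$ and $e_i\cap e_j=\emptyset$ if $|i-j|\ge 2$. The loose $s$-cycle $C_s^3$ is the $3$-uniform hypergraph with $s$ edges $e_1,\dots,e_s$ obtained from a loose $(s-1)$-path $e_1,\dots,e_{s-1}$ by adding an edge $e_s$ that shares one vertex with $e_1$, another vertex with $e_{s-1}$, and is disjoint from the other edges (so each vertex of $C_s^3$ lies in at most two edges, and $C_s^3$ has $2s$ vertices). *)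

theory Defs
  imports Complex_Main "HOL-Library.Landau_Symbols"
begin

record 'a hypergraph =
  verts :: "'a set"
  edges :: "'a set set"

definition three_graph :: "'a hypergraph \<Rightarrow> bool" where
  "three_graph G \<longleftrightarrow>
     finite (verts G) \<and> (\<forall>e\<in>edges G. e \<subseteq> verts G \<and> card e = 3)"

definition contains_copy :: "'a hypergraph \<Rightarrow> 'b hypergraph \<Rightarrow> bool" where
  "contains_copy G H \<longleftrightarrow>
     (\<exists>f. inj_on f (verts H) \<and> f ` verts H \<subseteq> verts G \<and> (\<forall>e\<in>edges H. f ` e \<in> edges G))"

definition hfree :: "'b hypergraph \<Rightarrow> 'a hypergraph \<Rightarrow> bool" where
  "hfree H G \<longleftrightarrow> \<not> contains_copy G H"

definition codegree :: "'a hypergraph \<Rightarrow> 'a set \<Rightarrow> nat" where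
  "codegree G p = card {e \<in> edges G. p \<subseteq> e}"

definition co2 :: "'a hypergraph \<Rightarrow> nat" where
  "co2 G = (\<Sum>p | p \<subseteq> verts G \<and> card p = 2. (codegree G p)\<^sup>2)"

(* Vertices are taken in nat, which loses nothing up to isomorphism since the vertex set is finite.
   The set of values is finite because co2 G is bounded in terms of n, and it is nonempty as soon
   as H has an edge, so Max is then a genuine maximum. *)
definition exco2 :: "nat \<Rightarrow> 'b hypergraph \<Rightarrow> nat" where
  "exco2 n H =
     Max {co2 G | G :: nat hypergraph. three_graph G \<and> card (verts G) = n \<and> hfree H G}"

(* e 1, ..., e s are the edges of a loose s-path; the values of e elsewhere are irrelevant. *)
definition loose_path_edges :: "nat \<Rightarrow> (nat \<Rightarrow> 'a set) \<Rightarrow> bool" where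
  "loose_path_edges s e \<longleftrightarrow>
     (\<forall>i\<in>{1..s}. card (e i) = 3) \<and>
     (\<forall>i\<in>{1..s}. \<forall>j\<in>{1..s}.
        (j = i + 1 \<longrightarrow> card (e i \<inter> e j) = 1) \<and> (i + 2 \<le> j \<longrightarrow> e i \<inter> e j = {}))"

definition loose_cycle_edges :: "nat \<Rightarrow> (nat \<Rightarrow> 'a set) \<Rightarrow> bool" where
  "loose_cycle_edges s e \<longleftrightarrow>
     loose_path_edges (s - 1) e \<and> card (e s) = 3 \<and>
     (\<exists>x y. x \<noteq> y \<and> e s \<inter> e 1 = {x} \<and> e s \<inter> e (s - 1) = {y}) \<and>
     (\<forall>i\<in>{2..s - 2}. e s \<inter> e i = {})"

(* P_s^3 and C_s^3 are determined only up to isomorphism, hence predicates. *)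
definition loose_path :: "nat \<Rightarrow> 'a hypergraph \<Rightarrow> bool" where
  "loose_path s H \<longleftrightarrow>
     (\<exists>e. loose_path_edges s e \<and> edges H = e ` {1..s} \<and> verts H = (\<Union>i\<in>{1..s}. e i))"

definition loose_cycle :: "nat \<Rightarrow> 'a hypergraph \<Rightarrow> bool" where
  "loose_cycle s H \<longleftrightarrow>
     (\<exists>e. loose_cycle_edges s e \<and> edges H = e ` {1..s} \<and> verts H = (\<Union>i\<in>{1..s}. e i))"

lemma loose_path_edges_nat: "loose_path_edges s (\<lambda>i. {2 * i, 2 * i + 1, 2 * i + 2 :: nat})"
proof -
  have "{2 * i, 2 * i + 1, 2 * i + 2} \<inter> {2 * (i + 1), 2 * (i + 1) + 1, 2 * (i + 1) + 2} = {2 * i + 2}"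
    for i :: nat by auto
  then show ?thesis unfolding loose_path_edges_def by auto
qed

lemma loose_path_exists: "\<exists>H :: nat hypergraph. loose_path s H"
  unfolding loose_path_def using loose_path_edges_nat[of s]
  by (metis hypergraph.select_convs)

lemma loose_cycle_exists:
  assumes "s \<ge> 3"
  shows "\<exists>H :: nat hypergraph. loose_cycle s H"
proof -
  define e :: "nat \<Rightarrow> nat set"
    where "e = (\<lambda>i. if i = s then {2 * s, 2 * s + 1, 2} else {2 * i, 2 * i + 1, 2 * i + 2})"
  have "loose_path_edges (s - 1) e = loose_path_edges (s - 1) (\<lambda>i. {2 * i, 2 * i + 1, 2 * i + 2 :: nat})"
    unfolding loose_path_edges_def e_def using assms by (intro conj_cong ball_cong) auto
  moreover have "e s \<inter> e 1 = {2}" "e s \<inter> e (s - 1) = {2 * s}"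
    using assms by (auto simp: e_def)
  moreover have "e s \<inter> e i = {}" if "i \<in> {2..s - 2}" for i
    using that assms by (auto simp: e_def)
  moreover have "card (e s) = 3" using assms by (auto simp: e_def)
  ultimately have "loose_cycle_edges s e"
    unfolding loose_cycle_edges_def using loose_path_edges_nat[of "s - 1"] assms by auto
  then show ?thesis unfolding loose_cycle_def by (metis hypergraph.select_convs)
qed

end

theory Submission
  imports Defs "HOL-Real_Asymp.Real_Asymp" "HOL-Library.Disjoint_Sets"
begin

text \<open>
  Put $t = \lfloor (s-1)/2 \rfloor$. The hypergraph of all triples meeting a fixed $t$-set shows the
  lower bound. For the upper bound call a pair heavy if its codegree is at least $4s$; the other
  pairs contribute $O(n^2)$. The heavy pairs contribute the sum over ordered pairs of vertices
  $(z, y)$ of the number of heavy pairs in the common link of $z$ and $y$. By greedy extension a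
  path of heavy pairs in the link of $z$ with $s$ edges yields both $P_s^3$ and $C_s^3$, and so
  does one with $s - 1$ edges whose first edge is extended by a vertex $y$ having, in the link of
  $z$, a neighbour off the path. With an Erdos--Gallai type decomposition of graphs without a path
  on $2t+3$ vertices this bounds the inner sum over $y$ by $tn^2 + O(n)$ for each $z$.
\<close>

subsection \<open>Graphs without long paths\<close>

text \<open>Parity shapes the proof. For \<open>s = 2t + 1\<close> a path on \<open>2t + 2\<close>
  vertices already has \<open>s\<close> edges and is excluded. For \<open>s = 2t + 2\<close> only
  paths on \<open>2t + 3\<close> vertices are excluded outright, and disjoint cliques on
  \<open>2t + 2\<close> vertices show that a graph without such paths can have
  \<open>t + 1/2\<close> edges per vertex, too many for the claimed constant. The extension by
  \<open>y\<close> exists to remove this surplus: the decomposition stores it as a family of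
  disjoint paths on \<open>2t + 2\<close> vertices, each worth at most \<open>t + 1\<close> extra
  edges, and a neighbour \<open>q\<close> of \<open>y\<close> in the link of \<open>z\<close> can
  lie on only one of two disjoint paths. A vertex \<open>y\<close> that is isolated in the heavy
  link of \<open>z\<close> offers no such \<open>q\<close> and gets a weaker bound, which is
  affordable because it is measured against the number of non-isolated vertices only.\<close>

definition pairs :: "'a set \<Rightarrow> 'a set set" where
  "pairs U = {e. e \<subseteq> U \<and> card e = 2}"

text \<open>Lengths of these lists count vertices, so a path with \<open>s\<close> edges has length
  \<open>s + 1\<close>. A one-element list is a path for every \<open>E\<close>, even if its vertex
  lies in no edge; facts that need an edge at each vertex therefore assume length at least
  2.\<close>

definition gpath :: "'a set set \<Rightarrow> 'a list \<Rightarrow> bool" where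
  "gpath E xs \<longleftrightarrow> distinct xs \<and> successively (\<lambda>x y. {x, y} \<in> E) xs"

lemma gpath_mono: "gpath E xs \<Longrightarrow> E \<subseteq> F \<Longrightarrow> gpath F xs"
  unfolding gpath_def by (auto intro: successively_mono)

lemma gpath_take: "gpath E xs \<Longrightarrow> gpath E (take n xs)"
  unfolding gpath_def by (metis append_take_drop_id distinct_take successively_append_iff)

lemma gpath_Cons: "gpath E (x # xs) \<longleftrightarrow> x \<notin> set xs \<and> gpath E xs \<and> (xs = [] \<or> {x, hd xs} \<in> E)"
  unfolding gpath_def by (auto simp: successively_Cons)

lemma gpath_Nil: "gpath E []"
  unfolding gpath_def by simp

lemma gpath_rev: "gpath E (rev xs) = gpath E xs"
  unfolding gpath_def by (simp add: insert_commute)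

lemma gpath_append:
  "gpath E (xs @ ys) \<longleftrightarrow> gpath E xs \<and> gpath E ys \<and> set xs \<inter> set ys = {} \<and>
     (xs = [] \<or> ys = [] \<or> {last xs, hd ys} \<in> E)"
  unfolding gpath_def by (auto simp: successively_append_iff)

lemma finite_pairs: "finite U \<Longrightarrow> finite (pairs U)"
  unfolding pairs_def by (rule finite_subset[of _ "Pow U"]) auto

lemma pairs_cases:
  assumes "e \<in> pairs U" "u \<in> e"
  obtains v where "e = {u, v}" "v \<in> U" "v \<noteq> u"
proof -
  have "card e = 2" "e \<subseteq> U" using assms by (auto simp: pairs_def)
  then obtain a b where "e = {a, b}" "a \<noteq> b" by (auto simp: card_2_iff)
  then show ?thesis using that[of b] that[of a] assms \<open>e \<subseteq> U\<close> by (auto simp: insert_commute)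
qed

lemma card_incident:
  assumes "E \<subseteq> pairs U"
  shows "card {e \<in> E. u \<in> e} = card {v. {u, v} \<in> E}"
proof -
  have "bij_betw (\<lambda>v. {u, v}) {v. {u, v} \<in> E} {e \<in> E. u \<in> e}"
    unfolding bij_betw_def
  proof
    show "inj_on (\<lambda>v. {u, v}) {v. {u, v} \<in> E}"
      by (auto simp: inj_on_def doubleton_eq_iff)
    show "(\<lambda>v. {u, v}) ` {v. {u, v} \<in> E} = {e \<in> E. u \<in> e}"
    proof
      show "{e \<in> E. u \<in> e} \<subseteq> (\<lambda>v. {u, v}) ` {v. {u, v} \<in> E}"
      proof
        fix e assume "e \<in> {e \<in> E. u \<in> e}"
        then have "e \<in> E" "u \<in> e" "e \<in> pairs U" using assms by auto
        then show "e \<in> (\<lambda>v. {u, v}) ` {v. {u, v} \<in> E}"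
          by (elim pairs_cases[of e U u]) auto
      qed
    qed auto
  qed
  from bij_betw_same_card[OF this] show ?thesis by simp
qed

text \<open>A longest path closes up to a cycle by the pigeonhole principle on the neighbours of its two
  ends, and a cycle with an edge leaving it would give a longer path.\<close>

lemma closed_path_exists:
  assumes U: "finite U" "U \<noteq> {}" and E: "E \<subseteq> pairs U"
    and deg: "\<And>u. u \<in> U \<Longrightarrow> t + 1 \<le> card {v. {u, v} \<in> E}"
    and nopath: "\<And>xs. gpath E xs \<Longrightarrow> length xs \<noteq> 2 * t + 3"
  obtains xs where "gpath E xs" "xs \<noteq> []" "set xs \<subseteq> U" "length xs \<le> 2 * t + 2"
    "\<And>x v. x \<in> set xs \<Longrightarrow> {x, v} \<in> E \<Longrightarrow> v \<in> set xs"
proof -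
  let ?P = "\<lambda>xs. gpath E xs \<and> xs \<noteq> [] \<and> set xs \<subseteq> U"
  obtain u0 where "u0 \<in> U" using U by auto
  then have "?P [u0]" by (auto simp: gpath_def)
  moreover have "\<forall>xs. ?P xs \<longrightarrow> length xs < Suc (card U)"
    using U(1) by (metis card_mono distinct_card gpath_def less_Suc_eq_le)
  ultimately obtain xs where xs: "?P xs" and max: "\<And>ys. ?P ys \<Longrightarrow> length ys \<le> length xs"
    using ex_has_greatest_nat[of ?P "[u0]" length "Suc (card U)"] by blast
  define n where "n = length xs"
  have n2: "n \<le> 2 * t + 2"
  proof (rule ccontr)
    assume "\<not> n \<le> 2 * t + 2"
    then have "length (take (2 * t + 3) xs) = 2 * t + 3" by (simp add: n_def)
    moreover have "gpath E (take (2 * t + 3) xs)" using xs gpath_take by blast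
    ultimately show False using nopath by blast
  qed
  have vU: "v \<in> U" if "{x, v} \<in> E" for x v using that E by (auto simp: pairs_def)
  have hd_nb: "v \<in> set xs" if "{hd xs, v} \<in> E" for v
  proof (rule ccontr)
    assume "v \<notin> set xs"
    then have "?P (v # xs)" using xs that vU[OF that] by (auto simp: gpath_Cons insert_commute)
    from max[OF this] show False by simp
  qed
  have last_nb: "v \<in> set xs" if "{last xs, v} \<in> E" for v
  proof (rule ccontr)
    assume "v \<notin> set xs"
    then have "?P (xs @ [v])" using xs that vU[OF that] by (auto simp: gpath_append gpath_Cons[of _ _ "[]"] gpath_Nil)
    from max[OF this] show False by simp
  qed
  have npos: "n > 0" using xs by (auto simp: n_def)
  have hd0: "hd xs = xs ! 0" and lastn: "last xs = xs ! (n - 1)"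
    using xs by (auto simp: hd_conv_nth last_conv_nth n_def)
  have dist: "distinct xs" using xs by (simp add: gpath_def)
  \<comment> \<open>An index \<open>i\<close> in both sets gives the two chords from
    \<open>xs ! 0\<close> to \<open>xs ! (i + 1)\<close> and from \<open>xs ! (n - 1)\<close> to
    \<open>xs ! i\<close> that turn the path into a cycle. Both sets live on
    \<open>n - 1 <= 2t + 1\<close> indices and have at least \<open>t + 1\<close> elements, hence
    they meet.\<close>
  define A where "A = {i. i < n - 1 \<and> {xs ! 0, xs ! (i + 1)} \<in> E}"
  define B where "B = {i. i < n - 1 \<and> {xs ! (n - 1), xs ! i} \<in> E}"
  have ne: "{x, x} \<notin> E" for x using E by (auto simp: pairs_def)
  have "{v. {hd xs, v} \<in> E} \<subseteq> (\<lambda>i. xs ! (i + 1)) ` A"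
  proof
    fix v assume v: "v \<in> {v. {hd xs, v} \<in> E}"
    then have "v \<in> set xs" using hd_nb by auto
    then obtain j where j: "j < n" "xs ! j = v" by (auto simp: in_set_conv_nth n_def)
    have "j \<noteq> 0" using v j hd0 ne by (metis mem_Collect_eq)
    then have "j - 1 \<in> A" "v = xs ! (j - 1 + 1)" using j v hd0 by (auto simp: A_def)
    then show "v \<in> (\<lambda>i. xs ! (i + 1)) ` A" by blast
  qed
  moreover have fA: "finite A" "finite B" by (auto simp: A_def B_def)
  ultimately have cA: "t + 1 \<le> card A"
    using deg[of "hd xs"] xs by (meson card_image_le card_mono finite_imageI hd_in_set le_trans subsetD)
  have "{v. {last xs, v} \<in> E} \<subseteq> (\<lambda>i. xs ! i) ` B"
  proof
    fix v assume v: "v \<in> {v. {last xs, v} \<in> E}"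
    then have "v \<in> set xs" using last_nb by auto
    then obtain j where j: "j < n" "xs ! j = v" by (auto simp: in_set_conv_nth n_def)
    have "j \<noteq> n - 1" using v j lastn ne by (metis mem_Collect_eq)
    then have "j \<in> B" using j v lastn by (auto simp: B_def)
    then show "v \<in> (\<lambda>i. xs ! i) ` B" using j by blast
  qed
  then have cB: "t + 1 \<le> card B"
    using deg[of "last xs"] xs fA by (meson card_image_le card_mono finite_imageI last_in_set le_trans subsetD)
  have "A \<inter> B \<noteq> {}"
  proof
    assume "A \<inter> B = {}"
    then have "card A + card B = card (A \<union> B)" using fA by (simp add: card_Un_disjoint)
    also have "\<dots> \<le> card {..<n - 1}" by (rule card_mono) (auto simp: A_def B_def)
    finally show False using cA cB n2 by simp
  qed
  then obtain i where i: "i < n - 1" "{xs ! 0, xs ! (i + 1)} \<in> E" "{xs ! (n - 1), xs ! i} \<in> E"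
    by (auto simp: A_def B_def)
  define as where "as = take (i + 1) xs"
  define bs where "bs = drop (i + 1) xs"
  have ab: "xs = as @ bs" "as \<noteq> []" "bs \<noteq> []" using i by (auto simp: as_def bs_def n_def)
  have hl: "hd as = xs ! 0" "last as = xs ! i" "hd bs = xs ! (i + 1)" "last bs = xs ! (n - 1)"
    using i hd0 lastn ab(2,3) unfolding as_def bs_def n_def
    by (simp_all add: hd_drop_conv_nth last_conv_nth[of "take _ _"] hd_conv_nth[of "take _ _"])
  \<comment> \<open>The cycle is cut at the chord from \<open>xs ! 0\<close> to
    \<open>xs ! (i + 1)\<close>, which becomes the closing edge \<open>close\<close>; the other
    chord joins \<open>as\<close> to the reversed tail.\<close>
  define ys where "ys = as @ rev bs"
  have ys: "gpath E ys" "set ys = set xs" "length ys = n" "ys \<noteq> []"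
  proof -
    have "gpath E (as @ bs)" using xs ab(1) by metis
    then have "gpath E as" "gpath E bs" "set as \<inter> set bs = {}"
      by (simp_all add: gpath_append)
    then show "gpath E ys"
      using ab(2,3) hl i(3) by (simp add: ys_def gpath_append gpath_rev hd_rev insert_commute)
    show "set ys = set xs" "length ys = n" "ys \<noteq> []"
      using ab(2) arg_cong[OF ab(1), of set] arg_cong[OF ab(1), of length]
      by (simp_all only: n_def ys_def) simp_all
  qed
  have close: "{last ys, hd ys} \<in> E" using ab(2,3) hl i(2) by (simp add: ys_def last_rev insert_commute)
  have "v \<in> set xs" if x: "x \<in> set xs" and xv: "{x, v} \<in> E" for x v
  proof (rule ccontr)
    assume v: "v \<notin> set xs"
    \<comment> \<open>Cutting the cycle in front of \<open>x\<close> and prepending \<open>v\<close>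
      gives a path on \<open>n + 1\<close> vertices.\<close>
    obtain cs ds where cd: "ys = cs @ x # ds" using x ys(2) by (metis split_list)
    have p: "gpath E (cs @ x # ds)" "v \<notin> set (cs @ x # ds)" using ys v cd by auto
    have "gpath E (v # (x # ds) @ cs)"
    proof (cases cs)
      case Nil
      then show ?thesis using p xv by (auto simp: gpath_Cons gpath_append insert_commute)
    next
      case (Cons c cs')
      have "gpath E (x # ds)" "gpath E cs" "set (x # ds) \<inter> set cs = {}"
        using p(1) unfolding gpath_append by blast+
      moreover have "{last (x # ds), hd cs} \<in> E" using close unfolding cd Cons by simp
      ultimately have "gpath E ((x # ds) @ cs)" unfolding gpath_append by blast
      then show ?thesis using p(2) xv unfolding gpath_Cons[of E v] by (auto simp: insert_commute)
    qed
    moreover have "set (v # (x # ds) @ cs) \<subseteq> U" using xs ys(2) vU[OF xv] cd by auto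
    ultimately have "length (v # (x # ds) @ cs) \<le> n" unfolding n_def by (intro max conjI) simp_all
    moreover have "length (cs @ x # ds) = n" using ys(3) cd by simp
    ultimately show False by simp
  qed
  then show ?thesis using that[of xs] xs n2 unfolding n_def by blast
qed

text \<open>Induction by removing either a vertex of degree at most \<open>t\<close> or, if there is
  none, a component spanned by a path. A removal costs at most \<open>t\<close> edges per vertex,
  except that a component on exactly \<open>2t + 2\<close> vertices can cost \<open>t + 1\<close>
  more; \<open>Q\<close> records these components.\<close>

lemma path_decomposition:
  assumes "finite U" and "E \<subseteq> pairs U"
    and "\<And>xs. gpath E xs \<Longrightarrow> length xs \<noteq> 2 * t + 3"
  shows "\<exists>Q. disjoint Q \<and> \<Union>Q \<subseteq> U \<and> (\<forall>q\<in>Q. \<exists>xs. gpath E xs \<and> length xs = 2 * t + 2 \<and> set xs = q) \<and>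
    card E \<le> t * card U + (t + 1) * card Q"
  using assms
proof (induction "card U" arbitrary: U E rule: less_induct)
  case less
  let ?R = "\<lambda>S. {e \<in> E. e \<inter> S = {}}"
  have fE: "finite E" using less.prems finite_pairs finite_subset by blast
  \<comment> \<open>Edges meeting the removed set \<open>S\<close> are charged separately. Paths of
    the smaller graph are still paths of \<open>E\<close>, so the members of \<open>Q\<close> carry
    over.\<close>
  have IH: "\<exists>Q. disjoint Q \<and> \<Union>Q \<subseteq> U - S \<and>
      (\<forall>q\<in>Q. \<exists>xs. gpath E xs \<and> length xs = 2 * t + 2 \<and> set xs = q) \<and>
      card E \<le> t * card (U - S) + (t + 1) * card Q + card {e \<in> E. e \<inter> S \<noteq> {}}"
    if S: "S \<subseteq> U" "S \<noteq> {}" for S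
  proof -
    have "card (U - S) < card U" using S less.prems(1) by (intro psubset_card_mono) auto
    moreover have "?R S \<subseteq> pairs (U - S)" using less.prems(2) by (auto simp: pairs_def)
    moreover have "gpath (?R S) xs \<Longrightarrow> length xs \<noteq> 2 * t + 3" for xs
      using less.prems(3)[of xs] gpath_mono[of "?R S" xs E] by auto
    ultimately obtain Q where Q: "disjoint Q" "\<Union>Q \<subseteq> U - S"
      "\<forall>q\<in>Q. \<exists>xs. gpath (?R S) xs \<and> length xs = 2 * t + 2 \<and> set xs = q"
      "card (?R S) \<le> t * card (U - S) + (t + 1) * card Q"
      using less.hyps[of "U - S" "?R S"] less.prems(1) by auto
    have "card E = card (?R S \<union> {e \<in> E. e \<inter> S \<noteq> {}})" by (rule arg_cong[of _ _ card]) auto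
    also have "\<dots> = card (?R S) + card {e \<in> E. e \<inter> S \<noteq> {}}"
      using fE by (intro card_Un_disjoint) auto
    finally show ?thesis using Q gpath_mono[of "?R S" _ E] by (intro exI[of _ Q]) fastforce
  qed
  consider "U = {}" | u where "u \<in> U" "card {v. {u, v} \<in> E} \<le> t"
    | "U \<noteq> {}" "\<And>u. u \<in> U \<Longrightarrow> t + 1 \<le> card {v. {u, v} \<in> E}" by force
  then show ?case
  proof cases
    case 1
    then have "E = {}" using less.prems(2) by (auto simp: pairs_def)
    then show ?thesis by (intro exI[of _ "{}"]) auto
  next
    case 2
    obtain Q where Q: "disjoint Q" "\<Union>Q \<subseteq> U - {u}"
      "\<forall>q\<in>Q. \<exists>xs. gpath E xs \<and> length xs = 2 * t + 2 \<and> set xs = q"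
      "card E \<le> t * card (U - {u}) + (t + 1) * card Q + card {e \<in> E. e \<inter> {u} \<noteq> {}}"
      using IH[of "{u}"] 2 by auto
    have "card {e \<in> E. e \<inter> {u} \<noteq> {}} \<le> t"
      using 2 card_incident[OF less.prems(2), of u] by simp
    moreover have "card U = card (U - {u}) + 1"
      using 2 less.prems(1) by (metis Suc_eq_plus1 card_Suc_Diff1)
    ultimately show ?thesis using Q by (intro exI[of _ Q]) auto
  next
    case 3
    from closed_path_exists[OF less.prems(1) 3(1) less.prems(2) 3(2) less.prems(3)]
    obtain xs where xs: "gpath E xs" "xs \<noteq> []" "set xs \<subseteq> U" "length xs \<le> 2 * t + 2"
      "\<And>x v. x \<in> set xs \<Longrightarrow> {x, v} \<in> E \<Longrightarrow> v \<in> set xs" by metis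
    define S where "S = set xs"
    define k where "k = length xs"
    have cS: "card S = k" using xs(1) by (simp add: S_def k_def gpath_def distinct_card)
    have k: "k \<ge> 1" using xs(2) by (cases xs) (auto simp: k_def)
    have "{e \<in> E. e \<inter> S \<noteq> {}} \<subseteq> {e. e \<subseteq> S \<and> card e = 2}"
    proof
      fix e assume "e \<in> {e \<in> E. e \<inter> S \<noteq> {}}"
      then obtain x where e: "e \<in> E" "x \<in> e" "x \<in> S" by auto
      then obtain v where "e = {x, v}" using pairs_cases less.prems(2) by (metis subsetD)
      then show "e \<in> {e. e \<subseteq> S \<and> card e = 2}"
        using xs(5)[of x v] e less.prems(2) by (auto simp: S_def pairs_def)
    qed
    then have "card {e \<in> E. e \<inter> S \<noteq> {}} \<le> card {e. e \<subseteq> S \<and> card e = 2}"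
      by (intro card_mono) (auto simp: S_def)
    also have "\<dots> = k choose 2" using n_subsets[of S 2] cS by (simp add: S_def)
    finally have c: "card {e \<in> E. e \<inter> S \<noteq> {}} \<le> k * (k - 1) div 2" by (simp add: choose_two)
    have S: "S \<subseteq> U" "S \<noteq> {}" using xs by (auto simp: S_def)
    from IH[OF this] obtain Q where Q: "disjoint Q" "\<Union>Q \<subseteq> U - S"
      "\<forall>q\<in>Q. \<exists>xs. gpath E xs \<and> length xs = 2 * t + 2 \<and> set xs = q"
      "card E \<le> t * card (U - S) + (t + 1) * card Q + card {e \<in> E. e \<inter> S \<noteq> {}}" by auto
    have cU: "card U = card (U - S) + k"
      using S cS less.prems(1) by (metis card_Diff_subset card_mono finite_subset le_add_diff_inverse2)
    show ?thesis
    \<comment> \<open>\<open>k choose 2\<close> is at most \<open>t * k\<close> exactly for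
      \<open>k <= 2 * t + 1\<close>; at \<open>k = 2 * t + 2\<close> the excess is
      \<open>t + 1\<close>, the price of one new member of \<open>Q\<close>.\<close>
    proof (cases "k \<le> 2 * t + 1")
      case True
      have "k * (k - 1) div 2 \<le> k * (2 * t) div 2" using True by (intro div_le_mono mult_left_mono) auto
      then have "card {e \<in> E. e \<inter> S \<noteq> {}} \<le> t * k" using c by (simp add: mult.commute mult.left_commute)
      then show ?thesis using Q cU by (intro exI[of _ Q]) (auto simp: algebra_simps)
    next
      case False
      then have k2: "k = 2 * t + 2" using xs(4) k_def by simp
      have "k * (k - 1) div 2 = t * k + (t + 1)" unfolding k2 by (simp add: algebra_simps)
      then have c2: "card {e \<in> E. e \<inter> S \<noteq> {}} \<le> t * k + (t + 1)" using c by simp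
      have "S \<notin> Q" using Q(2) S by auto
      moreover have "finite Q" using Q(2) less.prems(1) by (meson finite_Diff finite_UnionD finite_subset)
      ultimately have "card (insert S Q) = card Q + 1" by simp
      moreover have "disjoint (insert S Q)" using Q(1,2) by (auto simp: pairwise_insert disjnt_def)
      moreover have "\<forall>q\<in>insert S Q. \<exists>xs. gpath E xs \<and> length xs = 2 * t + 2 \<and> set xs = q"
        using Q(3) xs(1) k2 by (auto simp: S_def k_def)
      moreover have "\<Union>(insert S Q) \<subseteq> U" using Q(2) S by auto
      ultimately show ?thesis using Q(4) c2 cU by (intro exI[of _ "insert S Q"]) (auto simp: algebra_simps)
    qed
  qed
qed

text \<open>The members of \<open>Q\<close> are disjoint and have \<open>2t + 2\<close> vertices
  each, so they add at most half of \<open>card U\<close>. Rounding \<open>t + 1/2\<close> up to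
  \<open>2 * t\<close> loses nothing in the final count, where this bound serves the vertices
  isolated in the heavy link.\<close>

lemma card_edges_no_path:
  assumes "finite U" "E \<subseteq> pairs U" and "t \<ge> 1"
    and "\<And>xs. gpath E xs \<Longrightarrow> length xs \<noteq> 2 * t + 3"
  shows "card E \<le> 2 * t * card U"
proof -
  obtain Q where Q: "disjoint Q" "\<Union>Q \<subseteq> U"
      "\<forall>q\<in>Q. \<exists>xs. gpath E xs \<and> length xs = 2 * t + 2 \<and> set xs = q"
      "card E \<le> t * card U + (t + 1) * card Q"
    using path_decomposition[OF assms(1,2,4)] by blast
  have cq: "card q = 2 * t + 2" if "q \<in> Q" for q
    using Q(3) that by (metis distinct_card gpath_def)
  have "card (\<Union>Q) = (\<Sum>q\<in>Q. card q)"
    using Q(1,2) assms(1) by (intro card_Union_disjoint) (auto intro: finite_subset)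
  also have "\<dots> = (2 * t + 2) * card Q" using cq by simp
  finally have "(2 * t + 2) * card Q \<le> card U" using Q(2) assms(1) by (metis card_mono)
  then have "2 * ((t + 1) * card Q) \<le> card U" by simp
  moreover have "card U \<le> t * card U" using assms(3) by simp
  ultimately show ?thesis using Q(4) by linarith
qed

text \<open>Distinct members of \<open>Q\<close> are disjoint, so \<open>two\<close> leaves at most
  one of them.\<close>

lemma card_edges_no_two_paths:
  assumes "finite U" "E \<subseteq> pairs U"
    and "\<And>xs. gpath E xs \<Longrightarrow> length xs \<noteq> 2 * t + 3"
    and two: "\<And>xs ys. gpath E xs \<Longrightarrow> gpath E ys \<Longrightarrow> length xs = 2 * t + 2 \<Longrightarrow>
           length ys = 2 * t + 2 \<Longrightarrow> set xs \<inter> set ys \<noteq> {}"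
  shows "card E \<le> t * card U + (t + 1)"
proof -
  obtain Q where Q: "disjoint Q" "\<forall>q\<in>Q. \<exists>xs. gpath E xs \<and> length xs = 2 * t + 2 \<and> set xs = q"
      "card E \<le> t * card U + (t + 1) * card Q"
    using path_decomposition[OF assms(1-3)] by blast
  have "card Q \<le> Suc 0"
  proof (cases "finite Q")
    case True
    have "p = q" if "p \<in> Q" "q \<in> Q" for p q
    proof (rule ccontr)
      assume "p \<noteq> q"
      then have "p \<inter> q = {}" using Q(1) that by (auto simp: disjoint_def)
      moreover obtain xs where "gpath E xs" "length xs = 2 * t + 2" "set xs = p" using Q(2) \<open>p \<in> Q\<close> by blast
      moreover obtain ys where "gpath E ys" "length ys = 2 * t + 2" "set ys = q" using Q(2) \<open>q \<in> Q\<close> by blast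
      ultimately show False using two[of xs ys] by blast
    qed
    then show ?thesis using card_le_Suc0_iff_eq[OF True] by blast
  qed simp
  then have "(t + 1) * card Q \<le> (t + 1) * 1" by (intro mult_left_mono) auto
  then show ?thesis using Q(3) by simp
qed

subsection \<open>Embedding loose paths and cycles\<close>

text \<open>Greedy choice: whenever one more index is served, fewer than \<open>card I\<close>
  values are taken, so a set of size at least \<open>card I\<close> still has a free
  element.\<close>

lemma distinct_representatives:
  assumes "finite I" and "\<And>i. i \<in> I \<Longrightarrow> card I \<le> card (S i)"
  shows "\<exists>u. inj_on u I \<and> (\<forall>i\<in>I. u i \<in> S i)"
proof -
  have "\<exists>u. inj_on u J \<and> (\<forall>i\<in>J. u i \<in> S i)" if "finite J" "J \<subseteq> I" for J
    using that
  proof (induction J rule: finite_induct)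
    case (insert j J)
    then obtain u where u: "inj_on u J" "\<forall>i\<in>J. u i \<in> S i" by auto
    have "card J < card I"
      using insert assms(1) by (intro psubset_card_mono) auto
    then have "card (u ` J) < card (S j)"
      using assms(2)[of j] insert card_image_le[of J u] by auto
    then obtain v where v: "v \<in> S j" "v \<notin> u ` J"
      by (metis card_mono finite_imageI insert.hyps(1) leD subsetI)
    have "inj_on (u(j := v)) (insert j J)"
      using u v insert.hyps by (auto simp: inj_on_def)
    moreover have "\<forall>i\<in>insert j J. (u(j := v)) i \<in> S i" using u v by auto
    ultimately show ?case by blast
  qed auto
  then show ?thesis using assms(1) by blast
qed

text \<open>The link of a pair. The relation \<open>z \<in> conbrs G p\<close> is used in both
  directions: as membership in the link of \<open>p\<close>, and as \<open>p\<close> being an edge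
  of the link graph of \<open>z\<close>.\<close>

definition conbrs :: "'a hypergraph \<Rightarrow> 'a set \<Rightarrow> 'a set" where
  "conbrs G p = {v. v \<notin> p \<and> insert v p \<in> edges G}"

definition heavy :: "nat \<Rightarrow> 'a hypergraph \<Rightarrow> 'a set set" where
  "heavy K G = {p \<in> pairs (verts G). K \<le> codegree G p}"

lemma conbrs_subset: "three_graph G \<Longrightarrow> conbrs G p \<subseteq> verts G"
  by (auto simp: conbrs_def three_graph_def)

lemma codegree_eq:
  assumes G: "three_graph G" and p: "card p = 2"
  shows "codegree G p = card (conbrs G p)"
proof -
  have fp: "finite p" using p by (auto intro: card_ge_0_finite)
  have "bij_betw (\<lambda>v. insert v p) (conbrs G p) {e \<in> edges G. p \<subseteq> e}"
    unfolding bij_betw_def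
  proof
    show "inj_on (\<lambda>v. insert v p) (conbrs G p)"
      by (auto simp: inj_on_def conbrs_def)
    show "(\<lambda>v. insert v p) ` conbrs G p = {e \<in> edges G. p \<subseteq> e}"
    proof
      show "{e \<in> edges G. p \<subseteq> e} \<subseteq> (\<lambda>v. insert v p) ` conbrs G p"
      proof
        fix e assume e: "e \<in> {e \<in> edges G. p \<subseteq> e}"
        then have "card e = 3" using G by (auto simp: three_graph_def)
        then have "card (e - p) = 1" using e p fp by (simp add: card_Diff_subset)
        then obtain v where "e - p = {v}" by (auto simp: card_1_singleton_iff)
        then have "e = insert v p" "v \<notin> p" using e by auto
        then show "e \<in> (\<lambda>v. insert v p) ` conbrs G p" using e by (auto simp: conbrs_def)
      qed
    qed (auto simp: conbrs_def)
  qed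
  from bij_betw_same_card[OF this] show ?thesis by (simp add: codegree_def)
qed

lemma edge_distinct:
  assumes "three_graph G" "{u, v, w} \<in> edges G"
  shows "u \<noteq> v" "u \<noteq> w" "v \<noteq> w" "u \<in> verts G" "v \<in> verts G" "w \<in> verts G"
proof -
  have "card {u, v, w} = 3" using assms by (auto simp: three_graph_def)
  then show "u \<noteq> v" "u \<noteq> w" "v \<noteq> w" by (auto simp: card_insert_if split: if_splits)
  show "u \<in> verts G" "v \<in> verts G" "w \<in> verts G" using assms by (auto simp: three_graph_def)
qed

text \<open>The greedy core of all embeddings: \<open>g\<close> prescribes third vertices on
  \<open>I\<close>, and heaviness supplies the others. The sequence \<open>a\<close> of joints need
  not be injective, so the closed walk \<open>a s = a 0\<close> of a cycle is covered along with
  paths.\<close>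

lemma expand_joints:
  assumes G: "three_graph G" and I: "I \<subseteq> {..<s}" "inj_on g I" "g ` I \<inter> a ` {..s} = {}"
    and gE: "\<And>i. i \<in> I \<Longrightarrow> {a i, g i, a (Suc i)} \<in> edges G"
    and hv: "\<And>i. i < s \<Longrightarrow> i \<notin> I \<Longrightarrow> {a i, a (Suc i)} \<in> heavy (4 * s) G" and s: "s \<ge> 1"
  shows "\<exists>b. inj_on b {..<s} \<and> b ` {..<s} \<inter> a ` {..s} = {} \<and>
    (\<forall>i<s. {a i, b i, a (Suc i)} \<in> edges G)"
proof -
  define X where "X = a ` {..s} \<union> g ` I"
  have fI: "finite I" using I(1) finite_subset by blast
  have fX: "finite X" using fI by (simp add: X_def)
  have "card X \<le> card (a ` {..s}) + card (g ` I)" unfolding X_def by (rule card_Un_le)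
  also have "\<dots> \<le> Suc s + card I"
    using card_image_le[of "{..s}" a] card_image_le[OF fI, of g] by auto
  also have "card I \<le> s" using I(1) by (metis card_lessThan card_mono finite_lessThan)
  \<comment> \<open>At most \<open>s + 1\<close> joints and \<open>s\<close> prescribed vertices are
    forbidden, and \<open>2 * s + 1 <= 3 * s\<close>. With the threshold \<open>4 * s\<close> every
    heavy pair keeps at least \<open>s\<close> candidates, which is enough for at most
    \<open>s\<close> greedy choices.\<close>
  finally have cX: "card X \<le> 3 * s" using s by simp
  let ?J = "{..<s} - I"
  have "card ?J \<le> card {..<s}" by (rule card_mono) auto
  have c: "card ?J \<le> card (conbrs G {a i, a (Suc i)} - X)" if i: "i \<in> ?J" for i
  proof -
    have "{a i, a (Suc i)} \<in> heavy (4 * s) G" using hv i by auto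
    then have "4 * s \<le> card (conbrs G {a i, a (Suc i)})"
      using codegree_eq[OF G] by (auto simp: heavy_def pairs_def)
    then show ?thesis using diff_card_le_card_Diff[OF fX, of "conbrs G {a i, a (Suc i)}"] cX
      \<open>card ?J \<le> card {..<s}\<close> by simp
  qed
  obtain u where u: "inj_on u ?J" "\<forall>i\<in>?J. u i \<in> conbrs G {a i, a (Suc i)} - X"
    using distinct_representatives[of ?J "\<lambda>i. conbrs G {a i, a (Suc i)} - X"] c by auto
  define b where "b = (\<lambda>i. if i \<in> I then g i else u i)"
  have "inj_on b {..<s}"
  proof (rule inj_onI)
    fix i j assume ij: "i \<in> {..<s}" "j \<in> {..<s}" "b i = b j"
    have no: "g k \<noteq> u l" if "k \<in> I" "l \<in> ?J" for k l
    proof -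
      have "u l \<notin> g ` I" using u(2) that by (auto simp: X_def)
      then show ?thesis using that by force
    qed
    show "i = j"
      using ij I(2) u(1) no[of i j] no[of j i]
      by (auto simp: b_def inj_on_def split: if_splits)
  qed
  moreover have "b i \<notin> a ` {..s}" if "i < s" for i
    using u(2) I(3) that by (cases "i \<in> I") (auto simp: b_def X_def)
  then have "b ` {..<s} \<inter> a ` {..s} = {}" by blast
  moreover have "{a i, b i, a (Suc i)} \<in> edges G" if "i < s" for i
    using gE[of i] u(2) that by (auto simp: b_def conbrs_def insert_commute)
  ultimately show ?thesis by blast
qed

section \<open>Loose paths and cycles in coordinates\<close>

lemma relabel:
  assumes "inj_on a A" "inj_on b B" "b ` B \<inter> a ` A = {}"
    "inj_on a' A" "inj_on b' B" "b' ` B \<inter> a' ` A = {}"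
  obtains f where "inj_on f (a ` A \<union> b ` B)" "\<And>i. i \<in> A \<Longrightarrow> f (a i) = a' i" "\<And>i. i \<in> B \<Longrightarrow> f (b i) = b' i"
proof
  define f where "f = (\<lambda>v. if v \<in> a ` A then a' (the_inv_into A a v) else b' (the_inv_into B b v))"
  show fa: "f (a i) = a' i" if "i \<in> A" for i
    using that assms(1) by (simp add: f_def the_inv_into_f_f)
  show fb: "f (b i) = b' i" if "i \<in> B" for i
  proof -
    have "b i \<notin> a ` A" using assms(3) that by auto
    then show ?thesis using that assms(2) by (simp add: f_def the_inv_into_f_f)
  qed
  have "inj_on f (a ` A)" using assms(4) fa by (auto simp: inj_on_def)
  moreover have "inj_on f (b ` B)" using assms(5) fb by (auto simp: inj_on_def)
  moreover have "f ` a ` A = a' ` A" "f ` b ` B = b' ` B" using fa fb by force+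
  then have "f ` (a ` A - b ` B) \<subseteq> a' ` A" "f ` (b ` B - a ` A) \<subseteq> b' ` B" by blast+
  ultimately show "inj_on f (a ` A \<union> b ` B)"
    using assms(6) unfolding inj_on_Un by blast
qed

text \<open>Normal form of the abstract edge sequence, with edges counted from 1 and joints from 0.
  The ends \<open>x\<close> and \<open>y\<close> can be any vertices private to the first and last
  edge, because in a cycle they must be the vertices where the closing edge attaches.\<close>

lemma loose_path_labelling:
  assumes e: "loose_path_edges s e" and s: "s \<ge> 2"
    and x: "x \<in> e 1 - e 2" and y: "y \<in> e s - e (s - 1)"
  shows "\<exists>a b. a 0 = x \<and> a s = y \<and> inj_on a {..s} \<and> inj_on b {..<s} \<and> b ` {..<s} \<inter> a ` {..s} = {} \<and>
    (\<forall>i<s. e (Suc i) = {a i, b i, a (Suc i)})"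
proof -
  have c3: "card (e i) = 3" if "1 \<le> i" "i \<le> s" for i
    using e that by (auto simp: loose_path_edges_def)
  have c1: "card (e i \<inter> e (Suc i)) = 1" if "1 \<le> i" "i < s" for i
    using e that unfolding loose_path_edges_def by (metis Suc_eq_plus1 Suc_leI atLeastAtMost_iff le_SucI less_imp_le_nat)
  have far: "e i \<inter> e j = {}" if "1 \<le> i" "i + 2 \<le> j" "j \<le> s" for i j
    using e that by (auto simp: loose_path_edges_def)
  define a where "a = (\<lambda>i. if i = 0 then x else if i = s then y else the_elem (e i \<inter> e (Suc i)))"
  have a0: "a 0 = x" and as: "a s = y" using s by (auto simp: a_def)
  have ai: "e i \<inter> e (Suc i) = {a i}" if "1 \<le> i" "i < s" for i
  proof -
    have "card (e i \<inter> e (Suc i)) = 1" using c1 that by blast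
    then obtain v where "e i \<inter> e (Suc i) = {v}" by (elim card_1_singletonE)
    then show ?thesis using that by (simp add: a_def)
  qed
  \<comment> \<open>For \<open>s >= 2\<close> different joints lie in different sets of edges, so
    this incidence pattern yields their distinctness; together with \<open>b_mem\<close> it also
    separates \<open>a\<close> from \<open>b\<close>.\<close>
  have a_mem: "a i \<in> e k \<longleftrightarrow> k = i \<or> k = Suc i" if "i \<le> s" "1 \<le> k" "k \<le> s" for i k
  proof -
    consider "i = 0" | "i = s" | "1 \<le> i" "i < s" using \<open>i \<le> s\<close> by linarith
    then show ?thesis
    proof cases
      case 1
      have "x \<notin> e k" if "k \<ge> 2"
      proof (cases "k = 2")
        case False
        then have "1 + 2 \<le> k" using that by linarith
        then show ?thesis using far[of 1 k] x \<open>k \<le> s\<close> by auto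
      qed (use x in auto)
      then show ?thesis using 1 a0 x that by (cases "k = 1") auto
    next
      case 2
      have "y \<notin> e k" if "k < s"
      proof (cases "k = s - 1")
        case False
        then have "k + 2 \<le> s" using that by linarith
        then show ?thesis using far[of k s] y \<open>1 \<le> k\<close> by auto
      qed (use y in auto)
      then show ?thesis using 2 as y that by (cases "k = s") auto
    next
      case 3
      have m: "a i \<in> e i" "a i \<in> e (Suc i)" using ai[OF 3] by auto
      have "a i \<notin> e k" if "k < i" using far[of k "Suc i"] that m 3 \<open>1 \<le> k\<close> by auto
      moreover have "a i \<notin> e k" if "k > Suc i" using far[of i k] that m 3 \<open>k \<le> s\<close> by auto
      ultimately show ?thesis using m by (metis linorder_neqE_nat not_less_eq)
    qed
  qed
  have a_ne: "a i \<noteq> a j" if "i < j" "j \<le> s" for i j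
  proof
    assume eq: "a i = a j"
    have "a i \<in> e (Suc i)" using a_mem[of i "Suc i"] that by auto
    then have j: "j = Suc i" using a_mem[of j "Suc i"] that eq by auto
    show False
    proof (cases "i = 0")
      case True
      then show ?thesis using a_mem[of 0 2] a_mem[of 1 2] s j eq by auto
    next
      case False
      then show ?thesis using a_mem[of i i] a_mem[of j i] j eq that by auto
    qed
  qed
  have "\<exists>v. e (Suc i) = {a i, v, a (Suc i)} \<and> v \<noteq> a i \<and> v \<noteq> a (Suc i)" if i: "i < s" for i
  proof -
    have "{a i, a (Suc i)} \<subseteq> e (Suc i)" using a_mem[of i "Suc i"] a_mem[of "Suc i" "Suc i"] i by auto
    moreover have "card {a i, a (Suc i)} = 2" using a_ne[of i "Suc i"] i by simp
    ultimately have "card (e (Suc i) - {a i, a (Suc i)}) = 1"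
      using c3[of "Suc i"] i by (simp add: card_Diff_subset)
    then obtain v where "e (Suc i) - {a i, a (Suc i)} = {v}" by (auto simp: card_1_singleton_iff)
    then show ?thesis using \<open>{a i, a (Suc i)} \<subseteq> e (Suc i)\<close> by (intro exI[of _ v]) auto
  qed
  then obtain b where b: "\<And>i. i < s \<Longrightarrow> e (Suc i) = {a i, b i, a (Suc i)} \<and> b i \<noteq> a i \<and> b i \<noteq> a (Suc i)"
    by metis
  have b_mem: "k = Suc i" if "i < s" "1 \<le> k" "k \<le> s" "b i \<in> e k" for i k
  proof (rule ccontr)
    assume k: "k \<noteq> Suc i"
    have m: "b i \<in> e (Suc i)" using b that by auto
    consider "k < i" | "k = i" | "k = Suc (Suc i)" | "k \<ge> Suc i + 2" using k by linarith
    then show False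
    proof cases
      case 1
      then show ?thesis using far[of k "Suc i"] m that by auto
    next
      case 2
      then have "b i = a i" using ai[of i] m that by auto
      then show ?thesis using b that by blast
    next
      case 3
      then have "b i = a (Suc i)" using ai[of "Suc i"] m that by auto
      then show ?thesis using b that by blast
    next
      case 4
      then show ?thesis using far[of "Suc i" k] m that by auto
    qed
  qed
  have "inj_on a {..s}"
    by (rule inj_onI) (metis a_ne atMost_iff linorder_neqE_nat)
  moreover have "inj_on b {..<s}"
  proof (rule inj_onI)
    fix i j assume ij: "i \<in> {..<s}" "j \<in> {..<s}" "b i = b j"
    then have "b i \<in> e (Suc j)" using b[of j] by auto
    then show "i = j" using b_mem[of i "Suc j"] ij by auto
  qed
  moreover have "b j \<noteq> a i" if "j < s" "i \<le> s" for i j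
  proof
    assume eq: "b j = a i"
    show False
    proof (cases "i = s")
      case True
      then have "b j \<in> e s" using a_mem[of s s] s eq by auto
      then have "s = Suc j" using b_mem[of j s] that by auto
      then show False using b[of j] that eq True by auto
    next
      case False
      then have "b j \<in> e (Suc i)" using a_mem[of i "Suc i"] that eq by auto
      then have "i = j" using b_mem[of j "Suc i"] that False by auto
      then show False using b[of j] that eq by auto
    qed
  qed
  then have "b ` {..<s} \<inter> a ` {..s} = {}" by auto
  ultimately show ?thesis using a0 as b by blast
qed

lemma contains_loose_path:
  assumes P: "loose_path s P" and s: "s \<ge> 2" and G: "three_graph G"
    and a': "inj_on a' {..s}" and b': "inj_on b' {..<s}" "b' ` {..<s} \<inter> a' ` {..s} = {}"
    and E: "\<And>i. i < s \<Longrightarrow> {a' i, b' i, a' (Suc i)} \<in> edges G"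
  shows "contains_copy G P"
proof -
  obtain e where e: "loose_path_edges s e" "edges P = e ` {1..s}" "verts P = (\<Union>i\<in>{1..s}. e i)"
    using P by (auto simp: loose_path_def)
  have "card (e 1) = 3" "card (e s) = 3" using e(1) s by (auto simp: loose_path_edges_def)
  have "1 \<in> {1..s}" "2 \<in> {1..s}" "s - 1 \<in> {1..s}" "s \<in> {1..s}" "2 = 1 + (1::nat)" "s = s - 1 + 1"
    using s by auto
  then have c1: "card (e 1 \<inter> e 2) = 1" "card (e (s - 1) \<inter> e s) = 1"
    using e(1) unfolding loose_path_edges_def by blast+
  have "\<not> e 1 \<subseteq> e 2" using c1(1) \<open>card (e 1) = 3\<close> by (auto simp: Int_absorb2)
  then obtain x where x: "x \<in> e 1 - e 2" by auto
  have "\<not> e s \<subseteq> e (s - 1)" using c1(2) \<open>card (e s) = 3\<close> by (auto simp: Int_absorb1)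
  then obtain y where y: "y \<in> e s - e (s - 1)" by auto
  obtain a b where ab: "inj_on a {..s}" "inj_on b {..<s}" "b ` {..<s} \<inter> a ` {..s} = {}"
    "\<forall>i<s. e (Suc i) = {a i, b i, a (Suc i)}"
    using loose_path_labelling[OF e(1) s x y] by blast
  obtain f where f: "inj_on f (a ` {..s} \<union> b ` {..<s})" "\<And>i. i \<in> {..s} \<Longrightarrow> f (a i) = a' i"
    "\<And>i. i \<in> {..<s} \<Longrightarrow> f (b i) = b' i"
    using relabel[OF ab(1-3) a' b'] by blast
  have ix: "{1..s} = Suc ` {..<s}" by (simp add: image_Suc_lessThan)
  have img: "f ` e (Suc i) = {a' i, b' i, a' (Suc i)}" if "i < s" for i
    using ab(4) f(2)[of i] f(2)[of "Suc i"] f(3)[of i] that by auto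
  have "verts P \<subseteq> a ` {..s} \<union> b ` {..<s}" using ab(4) unfolding e(3) ix by auto
  then have "inj_on f (verts P)" using f(1) inj_on_subset by blast
  moreover have "\<forall>h\<in>edges P. f ` h \<in> edges G" using img E unfolding e(2) ix by auto
  moreover have "f ` verts P \<subseteq> verts G"
    using img E G unfolding e(3) ix three_graph_def by (fastforce simp: image_UN)
  ultimately show ?thesis unfolding contains_copy_def by blast
qed

text \<open>Without \<open>e s\<close> there remains a loose path with \<open>s - 1\<close> edges,
  whose ends are put at the attachment vertices \<open>x\<close> and \<open>y\<close>. The closing
  edge then brings only one new vertex \<open>w\<close>.\<close>

lemma contains_loose_cycle:
  assumes C: "loose_cycle s C" and s: "s \<ge> 4" and G: "three_graph G"
    and a': "inj_on a' {..<s}" "a' s = a' 0"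
    and b': "inj_on b' {..<s}" "b' ` {..<s} \<inter> a' ` {..s} = {}"
    and E: "\<And>i. i < s \<Longrightarrow> {a' i, b' i, a' (Suc i)} \<in> edges G"
  shows "contains_copy G C"
proof -
  obtain e where e: "loose_cycle_edges s e" "edges C = e ` {1..s}" "verts C = (\<Union>i\<in>{1..s}. e i)"
    using C by (auto simp: loose_cycle_def)
  obtain x y where xy: "x \<noteq> y" "e s \<inter> e 1 = {x}" "e s \<inter> e (s - 1) = {y}"
    using e(1) by (auto simp: loose_cycle_edges_def)
  have pe: "loose_path_edges (s - 1) e" and mid: "\<forall>i\<in>{2..s - 2}. e s \<inter> e i = {}" and cs: "card (e s) = 3"
    using e(1) by (auto simp: loose_cycle_edges_def)
  \<comment> \<open>By \<open>s >= 4\<close> the indices 2 and \<open>s - 2\<close> lie in the range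
    where \<open>e i\<close> is disjoint from \<open>e s\<close>, so \<open>x\<close> and
    \<open>y\<close> are private ends of the path.\<close>
  have x: "x \<in> e 1 - e 2" using xy(2) mid s by force
  have "s - 2 \<in> {2..s - 2}" using s by auto
  then have "y \<in> e (s - 1) - e (s - 2)" using xy(3) mid by blast
  then have y: "y \<in> e (s - 1) - e (s - 1 - 1)" by (simp add: numeral_2_eq_2)
  obtain a0 b0 where ab0: "a0 0 = x" "a0 (s - 1) = y" "inj_on a0 {..s - 1}" "inj_on b0 {..<s - 1}"
    "b0 ` {..<s - 1} \<inter> a0 ` {..s - 1} = {}" "\<forall>i<s - 1. e (Suc i) = {a0 i, b0 i, a0 (Suc i)}"
  proof -
    have "2 \<le> s - 1" using s by simp
    from loose_path_labelling[OF pe this x y] show ?thesis using that by blast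
  qed
  have "{x, y} \<subseteq> e s" "card {x, y} = 2" using xy by auto
  then have "card (e s - {x, y}) = 1" using cs by (simp add: card_Diff_subset)
  then obtain w where w: "e s - {x, y} = {w}" by (auto simp: card_1_singleton_iff)
  then have es: "e s = {y, w, x}" "w \<noteq> x" "w \<noteq> y" using \<open>{x, y} \<subseteq> e s\<close> by auto
  have w_out: "w \<notin> e (Suc i)" if "i < s - 1" for i
  proof
    assume wi: "w \<in> e (Suc i)"
    have "Suc i = 1 \<or> Suc i = s - 1 \<or> (2 \<le> Suc i \<and> Suc i \<le> s - 2)" using that by linarith
    then consider "Suc i = 1" | "Suc i = s - 1" | "Suc i \<in> {2..s - 2}" by auto
    then show False
    proof cases
      case 1
      then show ?thesis using wi xy(2) es by auto
    next
      case 2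
      then show ?thesis using wi xy(3) es by auto
    next
      case 3
      then show ?thesis using wi mid es by blast
    qed
  qed
  define a where "a = a0(s := x)"
  define b where "b = b0(s - 1 := w)"
  have sp: "Suc (s - 1) = s" "{..<s} = insert (s - 1) {..<s - 1}" "{..<s} = {..s - 1}" using s by auto
  have lab: "e (Suc i) = {a i, b i, a (Suc i)}" if "i < s" for i
  proof (cases "i = s - 1")
    case True
    then have "Suc i = s" "a i = y" "b i = w" using ab0(2) s by (auto simp: a_def b_def)
    then show ?thesis using es(1) by (simp add: a_def)
  next
    case False
    then have "i < s - 1" using that by simp
    then show ?thesis using ab0(6) by (auto simp: a_def b_def)
  qed
  have a_eq: "a i = a0 i" if "i < s" for i using that by (simp add: a_def)
  have ia: "inj_on a {..<s}" using ab0(3) a_eq sp(3) by (metis inj_on_cong lessThan_iff)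
  have w_b: "w \<noteq> b0 i" if "i < s - 1" for i using w_out[OF that] ab0(6) that by auto
  have w_a: "w \<noteq> a0 i" if "i < s" for i
  proof (cases "i = s - 1")
    case True
    then show ?thesis using ab0(2) es by simp
  next
    case False
    then have "i < s - 1" using that by simp
    then show ?thesis using w_out[of i] ab0(6) by auto
  qed
  have "inj_on b (insert (s - 1) {..<s - 1})"
    using ab0(4) w_b by (auto simp: b_def inj_on_def)
  then have ib: "inj_on b {..<s}" using sp(2) by metis
  have ba: "b ` {..<s} \<inter> a ` {..<s} = {}"
  proof -
    have "b i \<noteq> a j" if "i < s" "j < s" for i j
    proof (cases "i = s - 1")
      case True
      then show ?thesis using w_a[OF that(2)] a_eq[OF that(2)] by (simp add: b_def)
    next
      case False
      then have "b0 i \<in> b0 ` {..<s - 1}" "a0 j \<in> a0 ` {..s - 1}" using that by auto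
      then have "b0 i \<noteq> a0 j" using ab0(5) by (metis disjoint_iff)
      then show ?thesis using False a_eq[OF that(2)] by (simp add: b_def)
    qed
    then show ?thesis by auto
  qed
  have "b' ` {..<s} \<inter> a' ` {..<s} = {}" using b'(2) by force
  then obtain f where f: "inj_on f (a ` {..<s} \<union> b ` {..<s})" "\<And>i. i \<in> {..<s} \<Longrightarrow> f (a i) = a' i"
    "\<And>i. i \<in> {..<s} \<Longrightarrow> f (b i) = b' i"
    using relabel[OF ia ib ba a'(1) b'(1)] by blast
  have as: "a s = a 0" using ab0(1) s by (simp add: a_def)
  have fa: "f (a i) = a' i" if "i \<le> s" for i
  proof (cases "i = s")
    case True
    then show ?thesis using f(2)[of 0] as a'(2) s by simp
  qed (use f(2) that in simp)
  have ix: "{1..s} = Suc ` {..<s}" by (simp add: image_Suc_lessThan)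
  have img: "f ` e (Suc i) = {a' i, b' i, a' (Suc i)}" if "i < s" for i
    using lab[OF that] fa[of i] fa[of "Suc i"] f(3)[of i] that by auto
  have "a i \<in> a ` {..<s}" if "i \<le> s" for i
    using that as s by (cases "i = s") auto
  then have "verts C \<subseteq> a ` {..<s} \<union> b ` {..<s}" using lab unfolding e(3) ix by auto
  then have "inj_on f (verts C)" using f(1) inj_on_subset by blast
  moreover have "\<forall>h\<in>edges C. f ` h \<in> edges G" using img E unfolding e(2) ix by auto
  moreover have "f ` verts C \<subseteq> verts G"
    using img E G unfolding e(3) ix three_graph_def by (fastforce simp: image_UN)
  ultimately show ?thesis unfolding contains_copy_def by blast
qed

subsection \<open>Configurations of heavy pairs\<close>

text \<open>The link graph of \<open>z\<close> restricted to heavy pairs: each of its edges gives an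
  edge of \<open>G\<close> through \<open>z\<close> and, independently, a large supply of other
  third vertices.\<close>

definition heavy_link :: "nat \<Rightarrow> 'a hypergraph \<Rightarrow> 'a \<Rightarrow> 'a set set" where
  "heavy_link K G z = {p \<in> heavy K G. z \<in> conbrs G p}"

lemma heavy_link_edge: "{u, v} \<in> heavy_link K G z \<Longrightarrow> {z, u, v} \<in> edges G"
  by (simp add: heavy_link_def conbrs_def)

lemma heavy_link_subset: "heavy_link K G z \<subseteq> heavy K G"
  by (auto simp: heavy_link_def)

lemma gpath_nth: "gpath E xs \<Longrightarrow> Suc i < length xs \<Longrightarrow> {xs ! i, xs ! Suc i} \<in> E"
  by (simp add: gpath_def successively_conv_nth)

lemma gpath_vertex_in_edge:
  assumes "gpath E xs" "length xs \<ge> 2" "x \<in> set xs"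
  obtains p where "p \<in> E" "x \<in> p"
proof -
  obtain i where i: "i < length xs" "xs ! i = x" using assms(3) by (auto simp: in_set_conv_nth)
  show ?thesis
  proof (cases i)
    case 0
    then show ?thesis using gpath_nth[OF assms(1), of 0] assms(2) i that by auto
  next
    case (Suc j)
    then show ?thesis using gpath_nth[OF assms(1), of j] i that by auto
  qed
qed

lemma apex_notin_gpath:
  assumes "gpath (heavy_link K G z) xs" "length xs \<ge> 2"
  shows "z \<notin> set xs"
proof
  assume "z \<in> set xs"
  from gpath_vertex_in_edge[OF assms this] show False by (auto simp: heavy_link_def conbrs_def)
qed

text \<open>No apex is involved: with \<open>I\<close> empty, every third vertex is chosen
  greedily.\<close>

lemma heavy_path_copy:
  assumes G: "three_graph G" and P: "loose_path s P" and s: "s \<ge> 2"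
    and xs: "gpath (heavy (4 * s) G) xs" "length xs = s + 1"
  shows "contains_copy G P"
proof -
  have "\<exists>b. inj_on b {..<s} \<and> b ` {..<s} \<inter> (!) xs ` {..s} = {} \<and>
    (\<forall>i<s. {xs ! i, b i, xs ! Suc i} \<in> edges G)"
    using gpath_nth[OF xs(1)] xs(2) s by (intro expand_joints[OF G, of "{}" s undefined]) auto
  then obtain b where b: "inj_on b {..<s}" "b ` {..<s} \<inter> (!) xs ` {..s} = {}"
    "\<forall>i<s. {xs ! i, b i, xs ! Suc i} \<in> edges G" by blast
  have "inj_on ((!) xs) {..s}" using xs by (auto simp: gpath_def intro!: inj_on_nth)
  then show ?thesis using contains_loose_path[OF P s G _ b(1,2)] b(3) by blast
qed

text \<open>The ends of \<open>xs\<close> are spent as third vertices. The joints are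
  \<open>z\<close>, \<open>xs ! 1\<close>, ..., \<open>xs ! (s - 1)\<close>, and the two edges at
  \<open>z\<close> are \<open>{z, xs ! 0, xs ! 1}\<close> and
  \<open>{xs ! (s - 1), xs ! s, z}\<close>, provided by the link; all other pairs of consecutive
  joints are heavy.\<close>

lemma link_path_cycle_copy:
  assumes G: "three_graph G" and C: "loose_cycle s C" and s: "s \<ge> 4"
    and xs: "gpath (heavy_link (4 * s) G z) xs" "length xs = s + 1"
  shows "contains_copy G C"
proof -
  have "2 \<le> length xs" using xs(2) s by simp
  then have z: "z \<notin> set xs" by (rule apex_notin_gpath[OF xs(1)])
  have d: "distinct xs" using xs(1) by (simp add: gpath_def)
  define a where "a = (\<lambda>i. if i = 0 \<or> i = s then z else xs ! i)"
  define g where "g = (\<lambda>i::nat. if i = 0 then xs ! 0 else xs ! s)"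
  have a_eq: "a i = xs ! i" if "1 \<le> i" "i < s" for i using that by (simp add: a_def)
  have a0: "a 0 = z" "a s = z" by (auto simp: a_def)
  have ne: "xs ! i \<noteq> xs ! j" if "i \<noteq> j" "i \<le> s" "j \<le> s" for i j
    using that d xs(2) by (simp add: nth_eq_iff_index_eq)
  have nz: "xs ! i \<noteq> z" if "i \<le> s" for i using z that xs(2) by (metis Suc_eq_plus1 le_imp_less_Suc nth_mem)
  have E: "{xs ! i, xs ! Suc i} \<in> heavy_link (4 * s) G z" if "i < s" for i
    using gpath_nth[OF xs(1)] that xs(2) by simp
  have "\<exists>b. inj_on b {..<s} \<and> b ` {..<s} \<inter> a ` {..s} = {} \<and>
    (\<forall>i<s. {a i, b i, a (Suc i)} \<in> edges G)"
  proof (rule expand_joints[OF G, of "{0, s - 1}" s g])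
    show "inj_on g {0, s - 1}" using ne[of 0 s] s by (auto simp: g_def inj_on_def)
    have "xs ! 0 \<noteq> a i" "xs ! s \<noteq> a i" if "i \<le> s" for i
      using that ne[of 0 i] ne[of s i] nz[of 0] nz[of s] by (auto simp: a_def)
    then show "g ` {0, s - 1} \<inter> a ` {..s} = {}" by (auto simp: g_def)
    fix i assume i: "i \<in> {0, s - 1}"
    show "{a i, g i, a (Suc i)} \<in> edges G"
    proof (cases "i = 0")
      case True
      then show ?thesis using heavy_link_edge[OF E[of 0]] a0 a_eq[of 1] s by (simp add: g_def)
    next
      case False
      then have "i = s - 1" "Suc i = s" using i s by auto
      then show ?thesis using heavy_link_edge[OF E[of i]] a0 a_eq[of i] False s
        by (simp add: g_def insert_commute)
    qed
  next
    fix i assume i: "i < s" "i \<notin> {0, s - 1}"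
    then have "a i = xs ! i" "a (Suc i) = xs ! Suc i" by (auto intro!: a_eq)
    then show "{a i, a (Suc i)} \<in> heavy (4 * s) G" using E[of i] i heavy_link_subset[of "4 * s" G z] by auto
  qed (use s in auto)
  then obtain b where b: "inj_on b {..<s}" "b ` {..<s} \<inter> a ` {..s} = {}"
    "\<forall>i<s. {a i, b i, a (Suc i)} \<in> edges G" by blast
  have "inj_on a {..<s}"
  proof (rule inj_onI)
    fix i j assume "i \<in> {..<s}" "j \<in> {..<s}" "a i = a j"
    then show "i = j" using ne[of i j] nz[of i] nz[of j] by (auto simp: a_def split: if_splits)
  qed
  then show ?thesis using contains_loose_cycle[OF C s G _ _ b(1,2)] b(3) a0 by metis
qed

text \<open>The loose walk with joints z, y, xs!1, xs!2, ... starts with the edges {z, q, y} and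
  {y, xs!0, xs!1}. Its last edge has third vertex l, which is z for the cycle and the end of xs
  for the path.\<close>

lemma detour_joints:
  fixes s :: nat and z y :: 'a
  assumes G: "three_graph G" and s: "s \<ge> 4"
    and xs: "gpath (heavy_link (4 * s) G z) xs" "length xs = s"
    and y: "y \<in> conbrs G {xs ! 0, xs ! 1}" "y \<notin> set xs"
    and q: "{z, q, y} \<in> edges G" "q \<notin> set xs"
    and l: "l = z \<or> l = xs ! (s - 1)"
  defines "a \<equiv> (\<lambda>i. if i = 0 then z else if i = 1 then y else if i = s then l else xs ! (i - 1))"
  shows "inj_on a {..<s} \<and> (l \<noteq> z \<longrightarrow> inj_on a {..s}) \<and>
    (\<exists>b. inj_on b {..<s} \<and> b ` {..<s} \<inter> a ` {..s} = {} \<and> (\<forall>i<s. {a i, b i, a (Suc i)} \<in> edges G))"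
proof -
  have "2 \<le> length xs" using xs(2) s by simp
  then have z: "z \<notin> set xs" by (rule apex_notin_gpath[OF xs(1)])
  have d: "distinct xs" using xs(1) by (simp add: gpath_def)
  have qd: "z \<noteq> q" "z \<noteq> y" "q \<noteq> y" using edge_distinct[OF G q(1)] by auto
  have a_eq: "a i = xs ! (i - 1)" if "2 \<le> i" "i < s" for i using that by (simp add: a_def)
  have a0: "a 0 = z" "a 1 = y" "a s = l" using s by (auto simp: a_def)
  have mem: "xs ! i \<in> set xs" if "i < s" for i using that xs(2) by simp
  have ne: "xs ! i \<noteq> xs ! j" if "i \<noteq> j" "i < s" "j < s" for i j
    using that d xs(2) by (simp add: nth_eq_iff_index_eq)
  have nz: "xs ! i \<noteq> z" "xs ! i \<noteq> y" "xs ! i \<noteq> q" if "i < s" for i using z y q mem[OF that] by auto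
  have E: "{xs ! i, xs ! Suc i} \<in> heavy_link (4 * s) G z" if "Suc i < s" for i
    using gpath_nth[OF xs(1)] that xs(2) by simp
  define g where "g = (\<lambda>i::nat. if i = 0 then q else if i = 1 then xs ! 0 else xs ! (s - 1))"
  \<comment> \<open>For the cycle the last pair \<open>{xs ! (s - 2), z}\<close> need not be heavy,
    so its edge comes from the link of \<open>z\<close> with third vertex
    \<open>xs ! (s - 1)\<close>. For the path that vertex is the final joint, and the last pair is
    an edge of \<open>xs\<close>, hence heavy.\<close>
  define I where "I = (if l = z then {0, 1, s - 1} else {0, 1})"
  have a_val: "a j = xs ! (j - 1)" if "2 \<le> j" "j \<le> s" "j < s \<or> l \<noteq> z" for j
    using that l by (auto simp: a_def)
  have a_ne: "a i \<noteq> a j" if ij: "i < j" "j \<le> s" "j < s \<or> l \<noteq> z" for i j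
  proof (cases "j = 1")
    case True
    then show ?thesis using ij a0 qd by auto
  next
    case False
    then have j: "2 \<le> j" "j - 1 < s" using ij by auto
    consider "i = 0" | "i = 1" | "2 \<le> i" by linarith
    then show ?thesis
    proof cases
      case 3
      then have "i - 1 \<noteq> j - 1" "i - 1 < s" using ij by auto
      then show ?thesis using a_val[of i] a_val[of j] 3 j ij ne[of "i - 1" "j - 1"] by auto
    qed (use a0 a_val[of j] nz[of "j - 1"] ij j in auto)
  qed
  have "inj_on a {..<s}"
    by (rule inj_onI) (metis a_ne lessThan_iff less_imp_le linorder_neqE_nat)
  moreover have "inj_on a {..s}" if "l \<noteq> z"
    by (rule inj_onI) (metis a_ne atMost_iff linorder_neqE_nat that)
  moreover have "\<exists>b. inj_on b {..<s} \<and> b ` {..<s} \<inter> a ` {..s} = {} \<and>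
    (\<forall>i<s. {a i, b i, a (Suc i)} \<in> edges G)"
  proof (rule expand_joints[OF G, of I s g])
    show "I \<subseteq> {..<s}" using s by (auto simp: I_def)
    show "inj_on g I" using ne[of 0 "s - 1"] nz[of 0] nz[of "s - 1"] s
      by (auto simp: g_def I_def inj_on_def)
    have "g i \<noteq> a j" if "i \<in> I" "j \<le> s" for i j
    proof -
      have gi: "g i = q \<or> g i = xs ! 0 \<or> (g i = xs ! (s - 1) \<and> l = z)"
        using \<open>i \<in> I\<close> by (auto simp: g_def I_def split: if_splits)
      have "a j = z \<or> a j = y \<or> (2 \<le> j \<and> a j = xs ! (j - 1) \<and> (j < s \<or> l \<noteq> z))"
        using \<open>j \<le> s\<close> l by (auto simp: a_def)
      moreover have "g i \<noteq> z" "g i \<noteq> y" using gi nz[of 0] nz[of "s - 1"] qd s by auto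
      moreover have "g i \<noteq> xs ! (j - 1)" if "2 \<le> j" "j < s \<or> l \<noteq> z"
      proof -
        have j: "j - 1 < s" "0 \<noteq> j - 1" "0 < s" "s - 1 < s" "l = z \<Longrightarrow> s - 1 \<noteq> j - 1"
          using that \<open>j \<le> s\<close> s by auto
        show ?thesis using gi ne[OF j(2,3,1)] ne[OF j(5,4,1)] nz[OF j(1)] by metis
      qed
      ultimately show ?thesis by metis
    qed
    then show "g ` I \<inter> a ` {..s} = {}" by blast
    fix i assume "i \<in> I"
    then consider "i = 0" | "i = 1" | "i = s - 1" "l = z" by (auto simp: I_def split: if_splits)
    then show "{a i, g i, a (Suc i)} \<in> edges G"
    proof cases
      case 1
      then show ?thesis using q a0 by (simp add: g_def)
    next
      case 2
      have "a (Suc i) = xs ! 1" using 2 a_eq[of 2] s by (simp add: numeral_2_eq_2)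
      then show ?thesis using 2 a0 y by (simp add: g_def conbrs_def)
    next
      case 3
      have "{z, xs ! (s - 2), xs ! Suc (s - 2)} \<in> edges G"
        using heavy_link_edge[OF E[of "s - 2"]] s by simp
      moreover have "Suc (s - 2) = s - 1" "Suc (s - 1) = s" "s - 1 - 1 = s - 2" using s by auto
      moreover have "a i = xs ! (s - 2)" "a (Suc i) = z" "g i = xs ! (s - 1)"
        using 3 a0 a_eq[of "s - 1"] s calculation by (auto simp: g_def)
      ultimately show ?thesis by (simp add: insert_commute)
    qed
  next
    fix i assume i: "i < s" "i \<notin> I"
    then have i2: "2 \<le> i" "i < s" by (auto simp: I_def split: if_splits)
    have "a (Suc i) = xs ! i"
    proof (cases "Suc i = s")
      case True
      then have "l \<noteq> z" using i by (auto simp: I_def)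
      then show ?thesis using True l a0 by auto
    next
      case False
      then show ?thesis using a_eq[of "Suc i"] i2 by simp
    qed
    then have "{a i, a (Suc i)} = {xs ! (i - 1), xs ! Suc (i - 1)}" using a_eq[OF i2] i2 by simp
    then show "{a i, a (Suc i)} \<in> heavy (4 * s) G"
      using E[of "i - 1"] i2 heavy_link_subset[of "4 * s" G z] by auto
  qed (use s in auto)
  ultimately show ?thesis by blast
qed

lemma detour_cycle_copy:
  assumes G: "three_graph G" and s: "s \<ge> 4" and C: "loose_cycle s C"
    and xs: "gpath (heavy_link (4 * s) G z) xs" "length xs = s"
    and y: "y \<in> conbrs G {xs ! 0, xs ! 1}" "y \<notin> set xs"
    and q: "{z, q, y} \<in> edges G" "q \<notin> set xs"
  shows "contains_copy G C"
proof -
  define a where "a = (\<lambda>i. if i = 0 then z else if i = 1 then y else if i = s then z else xs ! (i - 1))"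
  obtain b where "inj_on a {..<s}" "inj_on b {..<s}" "b ` {..<s} \<inter> a ` {..s} = {}"
    "\<forall>i<s. {a i, b i, a (Suc i)} \<in> edges G"
    using detour_joints[OF G s xs y q, of z] unfolding a_def by blast
  moreover have "a s = a 0" using s by (simp add: a_def)
  ultimately show ?thesis using contains_loose_cycle[OF C s G] by blast
qed

lemma detour_path_copy:
  assumes G: "three_graph G" and s: "s \<ge> 4" and P: "loose_path s P"
    and xs: "gpath (heavy_link (4 * s) G z) xs" "length xs = s"
    and y: "y \<in> conbrs G {xs ! 0, xs ! 1}" "y \<notin> set xs"
    and q: "{z, q, y} \<in> edges G" "q \<notin> set xs"
  shows "contains_copy G P"
proof -
  define a where "a = (\<lambda>i. if i = 0 then z else if i = 1 then y else if i = s then xs ! (s - 1) else xs ! (i - 1))"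
  have "2 \<le> length xs" using xs(2) s by simp
  then have "z \<notin> set xs" by (rule apex_notin_gpath[OF xs(1)])
  then have "xs ! (s - 1) \<noteq> z" using xs(2) s by (metis diff_less less_le_trans nth_mem zero_less_numeral zero_less_one)
  then obtain b where b: "inj_on a {..s}" "inj_on b {..<s}" "b ` {..<s} \<inter> a ` {..s} = {}"
    "\<forall>i<s. {a i, b i, a (Suc i)} \<in> edges G"
    using detour_joints[OF G s xs y q, of "xs ! (s - 1)"] unfolding a_def by blast
  moreover have "2 \<le> s" using s by simp
  ultimately show ?thesis using contains_loose_path[OF P _ G] by blast
qed

subsection \<open>The upper bound\<close>

lemma card_pairs_le: "finite V \<Longrightarrow> card (pairs V) \<le> (card V)\<^sup>2"
proof -
  assume "finite V"
  then have "card (pairs V) = card V choose 2" unfolding pairs_def by (rule n_subsets)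
  also have "\<dots> \<le> card V * (card V - 1)" by (simp add: choose_two)
  also have "\<dots> \<le> (card V)\<^sup>2" by (simp add: power2_eq_square)
  finally show ?thesis .
qed

section \<open>Double counting of squared codegrees\<close>

lemma card_sq_eq_sum:
  fixes N :: "'a set"
  assumes "finite V" "N \<subseteq> V"
  shows "(card N)\<^sup>2 = (\<Sum>z\<in>V. \<Sum>y\<in>V. of_bool (z \<in> N \<and> y \<in> N))"
proof -
  have c: "card N = (\<Sum>z\<in>V. of_bool (z \<in> N))"
    using assms by (simp add: sum.If_cases of_bool_def Int_absorb1)
  show ?thesis
    unfolding power2_eq_square by (subst (1 2) c) (auto simp: sum_product intro!: sum.cong)
qed

lemma sum_codegree_sq_eq:
  assumes G: "three_graph G" and F: "F \<subseteq> pairs (verts G)"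
  shows "(\<Sum>p\<in>F. (codegree G p)\<^sup>2) =
    (\<Sum>z\<in>verts G. \<Sum>y\<in>verts G. card {p \<in> F. z \<in> conbrs G p \<and> y \<in> conbrs G p})"
proof -
  let ?V = "verts G"
  have fV: "finite ?V" using G by (simp add: three_graph_def)
  have fF: "finite F" using F finite_pairs[OF fV] finite_subset by blast
  have "(\<Sum>p\<in>F. (codegree G p)\<^sup>2) =
    (\<Sum>p\<in>F. \<Sum>z\<in>?V. \<Sum>y\<in>?V. of_bool (z \<in> conbrs G p \<and> y \<in> conbrs G p))"
  proof (rule sum.cong)
    fix p assume "p \<in> F"
    then have "codegree G p = card (conbrs G p)" using F codegree_eq[OF G] by (auto simp: pairs_def)
    then show "(codegree G p)\<^sup>2 = (\<Sum>z\<in>?V. \<Sum>y\<in>?V. of_bool (z \<in> conbrs G p \<and> y \<in> conbrs G p))"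
      using card_sq_eq_sum[OF fV conbrs_subset[OF G, of p]] by simp
  qed simp
  also have "\<dots> = (\<Sum>z\<in>?V. \<Sum>p\<in>F. \<Sum>y\<in>?V. of_bool (z \<in> conbrs G p \<and> y \<in> conbrs G p))"
    by (rule sum.swap)
  also have "\<dots> = (\<Sum>z\<in>?V. \<Sum>y\<in>?V. \<Sum>p\<in>F. of_bool (z \<in> conbrs G p \<and> y \<in> conbrs G p))"
    by (rule sum.cong[OF refl], rule sum.swap)
  also have "\<dots> = (\<Sum>z\<in>?V. \<Sum>y\<in>?V. card {p \<in> F. z \<in> conbrs G p \<and> y \<in> conbrs G p})"
    using fF by (intro sum.cong refl) (simp add: of_bool_def sum.If_cases Int_def)
  finally show ?thesis .
qed

text \<open>Let m be the number of vertices that are not isolated in the heavy link of z. If y is such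
  a vertex, two disjoint long paths in the common heavy link of y and z would leave a neighbour q
  of y in the link of z off one of them, so this common link has at most t m + t + 1 edges. The
  weaker bound 2 t m for the remaining n - m vertices y is good enough since
  t m m + 2 t m (n - m) is at most t n n.\<close>

lemma sum_common_link_le:
  assumes G: "three_graph G" and t: "t \<ge> 1"
    and A: "\<And>xs. gpath (heavy_link K G z) xs \<Longrightarrow> length xs \<noteq> 2 * t + 3"
    and B: "\<And>xs y q. gpath (heavy_link K G z) xs \<Longrightarrow> length xs = 2 * t + 2 \<Longrightarrow>
       y \<in> conbrs G {xs ! 0, xs ! 1} \<Longrightarrow> y \<notin> set xs \<Longrightarrow> q \<notin> set xs \<Longrightarrow> {z, q, y} \<notin> edges G"
  shows "(\<Sum>y\<in>verts G. card {p \<in> heavy_link K G z. y \<in> conbrs G p}) \<le>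
    t * (card (verts G))\<^sup>2 + (t + 1) * card (verts G)"
proof -
  let ?V = "verts G" and ?L = "heavy_link K G z"
  define LL where "LL = (\<lambda>y. {p \<in> ?L. y \<in> conbrs G p})"
  define U where "U = \<Union>?L"
  have fV: "finite ?V" using G by (simp add: three_graph_def)
  have LV: "?L \<subseteq> pairs ?V" by (auto simp: heavy_link_def heavy_def)
  then have UV: "U \<subseteq> ?V" by (auto simp: U_def pairs_def)
  have fU: "finite U" using UV fV finite_subset by blast
  have LU: "LL y \<subseteq> pairs U" for y using LV by (auto simp: LL_def U_def pairs_def)
  have sub: "gpath (LL y) xs \<Longrightarrow> gpath ?L xs" for y xs
    by (erule gpath_mono) (auto simp: LL_def)
  define n where "n = card ?V"
  define m where "m = card U"
  \<comment> \<open>A common link is a subgraph of the heavy link of \<open>z\<close>, so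
    \<open>A\<close> applies for every \<open>y\<close>, including \<open>y = z\<close>.\<close>
  have b1: "card (LL y) \<le> 2 * t * m" for y
    unfolding m_def using A sub by (intro card_edges_no_path[OF fU LU t]) blast
  have b2: "card (LL y) \<le> t * m + (t + 1)" if "y \<in> U" for y
    unfolding m_def
  proof (rule card_edges_no_two_paths[OF fU LU])
    show "gpath (LL y) xs \<Longrightarrow> length xs \<noteq> 2 * t + 3" for xs using A sub by blast
    fix xs ys assume xy: "gpath (LL y) xs" "gpath (LL y) ys" "length xs = 2 * t + 2" "length ys = 2 * t + 2"
    obtain p where p: "p \<in> ?L" "y \<in> p" using \<open>y \<in> U\<close> by (auto simp: U_def)
    then obtain q where q: "p = {y, q}" using LV by (meson pairs_cases subsetD)
    have "{q, y} \<in> ?L" using p q by (simp add: insert_commute)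
    then have E: "{z, q, y} \<in> edges G" by (rule heavy_link_edge)
    have "q \<in> set ws" if "gpath (LL y) ws" "length ws = 2 * t + 2" for ws
    proof (rule ccontr)
      assume q: "q \<notin> set ws"
      have "{ws ! 0, ws ! 1} \<in> LL y" using gpath_nth[OF that(1), of 0] that(2) by simp
      then have "y \<in> conbrs G {ws ! 0, ws ! 1}" by (simp add: LL_def)
      moreover have "y \<notin> set ws"
      proof
        assume "y \<in> set ws"
        with gpath_vertex_in_edge[OF that(1) _ this] that(2) show False
          by (auto simp: LL_def conbrs_def)
      qed
      ultimately show False using B[OF sub[OF that(1)] that(2) _ _ q] E by blast
    qed
    then show "set xs \<inter> set ys \<noteq> {}" using xy by blast
  qed
  have mn: "m \<le> n" unfolding m_def n_def using UV fV by (rule card_mono[rotated])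
  have "(\<Sum>y\<in>?V. card (LL y)) = (\<Sum>y\<in>U. card (LL y)) + (\<Sum>y\<in>?V - U. card (LL y))"
    using sum.subset_diff[OF UV fV, of "\<lambda>y. card (LL y)"] by simp
  also have "(\<Sum>y\<in>U. card (LL y)) \<le> m * (t * m + (t + 1))"
    using sum_bounded_above[of U "\<lambda>y. card (LL y)" "t * m + (t + 1)"] b2 by (simp add: m_def)
  also have "(\<Sum>y\<in>?V - U. card (LL y)) \<le> (n - m) * (2 * t * m)"
    using sum_bounded_above[of "?V - U" "\<lambda>y. card (LL y)" "2 * t * m"] b1 UV fU
    by (simp add: n_def m_def card_Diff_subset)
  also have "m * (t * m + (t + 1)) + (n - m) * (2 * t * m) \<le> t * n\<^sup>2 + (t + 1) * n"
  proof -
    \<comment> \<open>The slack is exactly \<open>t * d^2 + (t + 1) * d\<close>, since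
      \<open>2 * t * m * d\<close> is the mixed term of \<open>t * (m + d)^2\<close>. This is why
      the factor \<open>2 * t\<close> for isolated vertices does no harm.\<close>
    obtain d where "n = m + d" using mn le_Suc_ex by blast
    then show ?thesis by (simp add: algebra_simps power2_eq_square)
  qed
  finally show ?thesis by (simp add: LL_def n_def)
qed

text \<open>\<open>A\<close> and \<open>B\<close> isolate what freeness has to deliver, so one count
  with an arbitrary threshold \<open>K\<close> serves both cycles and paths.\<close>

lemma co2_upper_bound:
  assumes G: "three_graph G" and t: "t \<ge> 1"
    and A: "\<And>z xs. gpath (heavy_link K G z) xs \<Longrightarrow> length xs \<noteq> 2 * t + 3"
    and B: "\<And>z xs y q. gpath (heavy_link K G z) xs \<Longrightarrow> length xs = 2 * t + 2 \<Longrightarrow>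
       y \<in> conbrs G {xs ! 0, xs ! 1} \<Longrightarrow> y \<notin> set xs \<Longrightarrow> q \<notin> set xs \<Longrightarrow> {z, q, y} \<notin> edges G"
  shows "co2 G \<le> t * card (verts G) ^ 3 + (t + 1 + K\<^sup>2) * (card (verts G))\<^sup>2"
proof -
  let ?V = "verts G"
  define n where "n = card ?V"
  have fV: "finite ?V" using G by (simp add: three_graph_def)
  have fP: "finite (pairs ?V)" using finite_pairs[OF fV] .
  have hP: "heavy K G \<subseteq> pairs ?V" by (auto simp: heavy_def)
  have "co2 G = (\<Sum>p\<in>pairs ?V. (codegree G p)\<^sup>2)" by (simp add: co2_def pairs_def)
  also have "\<dots> = (\<Sum>p\<in>pairs ?V - heavy K G. (codegree G p)\<^sup>2) + (\<Sum>p\<in>heavy K G. (codegree G p)\<^sup>2)"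
    by (rule sum.subset_diff[OF hP fP])
  also have "(\<Sum>p\<in>pairs ?V - heavy K G. (codegree G p)\<^sup>2) \<le> K\<^sup>2 * n\<^sup>2"
  proof -
    have "(codegree G p)\<^sup>2 \<le> K\<^sup>2" if "p \<in> pairs ?V - heavy K G" for p
      using that by (intro power_mono) (auto simp: heavy_def)
    then have "(\<Sum>p\<in>pairs ?V - heavy K G. (codegree G p)\<^sup>2) \<le> card (pairs ?V - heavy K G) * K\<^sup>2"
      using sum_bounded_above[of "pairs ?V - heavy K G" "\<lambda>p. (codegree G p)\<^sup>2" "K\<^sup>2"] by simp
    also have "card (pairs ?V - heavy K G) \<le> card (pairs ?V)" using fP by (intro card_mono) auto
    also have "\<dots> \<le> n\<^sup>2" unfolding n_def by (rule card_pairs_le[OF fV])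
    finally show ?thesis by (simp add: mult.commute)
  qed
  also have "(\<Sum>p\<in>heavy K G. (codegree G p)\<^sup>2) \<le> n * (t * n\<^sup>2 + (t + 1) * n)"
  proof -
    have "(\<Sum>p\<in>heavy K G. (codegree G p)\<^sup>2) =
      (\<Sum>z\<in>?V. \<Sum>y\<in>?V. card {p \<in> heavy K G. z \<in> conbrs G p \<and> y \<in> conbrs G p})"
      by (rule sum_codegree_sq_eq[OF G hP])
    also have "\<dots> = (\<Sum>z\<in>?V. \<Sum>y\<in>?V. card {p \<in> heavy_link K G z. y \<in> conbrs G p})"
      by (simp add: heavy_link_def)
    also have "\<dots> \<le> (\<Sum>z\<in>?V. t * n\<^sup>2 + (t + 1) * n)"
      unfolding n_def by (rule sum_mono) (rule sum_common_link_le[OF G t A B])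
    finally show ?thesis by (simp add: n_def)
  qed
  finally show ?thesis by (simp add: n_def algebra_simps power2_eq_square power3_eq_cube)
qed

lemma co2_cycle_free_le:
  assumes C: "loose_cycle s C" and s: "s \<ge> 4" and G: "three_graph G" "hfree C G"
  defines "t \<equiv> (s - 1) div 2"
  shows "co2 G \<le> t * card (verts G) ^ 3 + (t + 1 + (4 * s)\<^sup>2) * (card (verts G))\<^sup>2"
proof (rule co2_upper_bound[OF G(1)])
  have free: "\<not> contains_copy G C" using G(2) by (simp add: hfree_def)
  have noS: "length xs \<noteq> s + 1" if "gpath (heavy_link (4 * s) G z) xs" for z xs
    using link_path_cycle_copy[OF G(1) C s that] free by blast
  show "1 \<le> t" using s by (simp add: t_def)
  \<comment> \<open>In either case a path on \<open>2 * t + 3\<close> vertices can be truncated to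
    \<open>s + 1\<close> vertices. A path on \<open>2 * t + 2\<close> vertices has \<open>s\<close>
    edges for odd \<open>s\<close>, which makes the second condition vacuous, and
    \<open>s - 1\<close> edges for even \<open>s\<close>, where the detour applies.\<close>
  have ts: "s = 2 * t + 1 \<or> s = 2 * t + 2" unfolding t_def using s by presburger
  show "length xs \<noteq> 2 * t + 3" if "gpath (heavy_link (4 * s) G z) xs" for z xs
    using noS[OF gpath_take[OF that, of "s + 1"]] ts by auto
  show "{z, q, y} \<notin> edges G" if "gpath (heavy_link (4 * s) G z) xs" "length xs = 2 * t + 2"
    "y \<in> conbrs G {xs ! 0, xs ! 1}" "y \<notin> set xs" "q \<notin> set xs" for z xs y q
    using ts
  proof
    assume "s = 2 * t + 1"
    then show ?thesis using noS[OF that(1)] that(2) by simp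
  next
    assume "s = 2 * t + 2"
    then show ?thesis using detour_cycle_copy[OF G(1) s C that(1) _ that(3,4) _ that(5)] that(2) free by auto
  qed
qed

text \<open>As for cycles, except that a path with \<open>s\<close> edges is excluded already in the
  graph of all heavy pairs.\<close>

lemma co2_path_free_le:
  assumes P: "loose_path s P" and s: "s \<ge> 4" and G: "three_graph G" "hfree P G"
  defines "t \<equiv> (s - 1) div 2"
  shows "co2 G \<le> t * card (verts G) ^ 3 + (t + 1 + (4 * s)\<^sup>2) * (card (verts G))\<^sup>2"
proof (rule co2_upper_bound[OF G(1)])
  have free: "\<not> contains_copy G P" using G(2) by (simp add: hfree_def)
  have noS: "length xs \<noteq> s + 1" if "gpath (heavy_link (4 * s) G z) xs" for z xs
    using heavy_path_copy[OF G(1) P _ gpath_mono[OF that heavy_link_subset]] s free by auto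
  show "1 \<le> t" using s by (simp add: t_def)
  have ts: "s = 2 * t + 1 \<or> s = 2 * t + 2" unfolding t_def using s by presburger
  show "length xs \<noteq> 2 * t + 3" if "gpath (heavy_link (4 * s) G z) xs" for z xs
    using noS[OF gpath_take[OF that, of "s + 1"]] ts by auto
  show "{z, q, y} \<notin> edges G" if "gpath (heavy_link (4 * s) G z) xs" "length xs = 2 * t + 2"
    "y \<in> conbrs G {xs ! 0, xs ! 1}" "y \<notin> set xs" "q \<notin> set xs" for z xs y q
    using ts
  proof
    assume "s = 2 * t + 1"
    then show ?thesis using noS[OF that(1)] that(2) by simp
  next
    assume "s = 2 * t + 2"
    then show ?thesis using detour_path_copy[OF G(1) s P that(1) _ that(3,4) _ that(5)] that(2) free by auto
  qed
qed

subsection \<open>The lower bound and the asymptotics\<close>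

text \<open>Edges whose indices differ by at least 2 are disjoint, so only the first edge containing
  \<open>v\<close> and its successor can contain \<open>v\<close>.\<close>

lemma loose_path_edges_degree_le:
  assumes "loose_path_edges s e"
  shows "card {i \<in> {1..s}. v \<in> e i} \<le> 2"
proof (cases "{i \<in> {1..s}. v \<in> e i} = {}")
  case False
  let ?S = "{i \<in> {1..s}. v \<in> e i}"
  define m where "m = Min ?S"
  have m: "m \<in> ?S" unfolding m_def using False by (intro Min_in) auto
  have "?S \<subseteq> {m, m + 1}"
  proof
    fix i assume i: "i \<in> ?S"
    then have "m \<le> i" unfolding m_def by (intro Min_le) auto
    moreover have "\<not> m + 2 \<le> i"
      using m i assms unfolding loose_path_edges_def by blast
    ultimately show "i \<in> {m, m + 1}" by auto
  qed
  then have "card ?S \<le> card {m, m + 1}" by (intro card_mono) auto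
  then show ?thesis by simp
next
  case True
  then show ?thesis by (metis card.empty le0)
qed

text \<open>Besides \<open>e s\<close>, a vertex of \<open>e s\<close> can lie only in
  \<open>e 1\<close> or \<open>e (s - 1)\<close>, and these two are disjoint for
  \<open>s >= 4\<close>.\<close>

lemma loose_cycle_edges_degree_le:
  assumes e: "loose_cycle_edges s e" and s: "s \<ge> 4"
  shows "card {i \<in> {1..s}. v \<in> e i} \<le> 2"
proof -
  have pe: "loose_path_edges (s - 1) e" and mid: "\<forall>i\<in>{2..s - 2}. e s \<inter> e i = {}"
    using e by (auto simp: loose_cycle_edges_def)
  let ?S = "{i \<in> {1..s - 1}. v \<in> e i}"
  have ins: "{1..s} = insert s {1..s - 1}" using s by auto
  show ?thesis
  proof (cases "v \<in> e s")
    case False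
    then have "{i \<in> {1..s}. v \<in> e i} = ?S" unfolding ins by auto
    then show ?thesis using loose_path_edges_degree_le[OF pe, of v] by simp
  next
    case True
    have "i = 1 \<or> i = s - 1" if "i \<in> ?S" for i
    proof (rule ccontr)
      assume "\<not> (i = 1 \<or> i = s - 1)"
      then have "i \<in> {2..s - 2}" using that by auto
      then show False using mid that True by blast
    qed
    moreover have "\<not> (1 \<in> ?S \<and> s - 1 \<in> ?S)"
    proof -
      have "1 \<in> {1..s - 1}" "s - 1 \<in> {1..s - 1}" "1 + 2 \<le> s - 1" using s by auto
      then have "e 1 \<inter> e (s - 1) = {}" using pe unfolding loose_path_edges_def by blast
      then show ?thesis by blast
    qed
    ultimately have "?S \<subseteq> {1} \<or> ?S \<subseteq> {s - 1}" by blast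
    then obtain k where k: "?S \<subseteq> {k}" by blast
    have "{i \<in> {1..s}. v \<in> e i} \<subseteq> {s, k}" using k unfolding ins by blast
    then have "card {i \<in> {1..s}. v \<in> e i} \<le> card {s, k}" by (intro card_mono) auto
    also have "\<dots> \<le> 2" by (simp add: card_insert_if)
    finally show ?thesis .
  qed
qed

definition star_graph :: "nat \<Rightarrow> nat \<Rightarrow> nat hypergraph" where
  "star_graph t n = \<lparr>verts = {..<n}, edges = {e. e \<subseteq> {..<n} \<and> card e = 3 \<and> e \<inter> {..<t} \<noteq> {}}\<rparr>"

lemma three_graph_star: "three_graph (star_graph t n)"
  by (auto simp: three_graph_def star_graph_def)

text \<open>The t centres would have to cover the s edges of a copy, but each covers at most two.\<close>

lemma star_graph_hfree:
  assumes H: "edges H = e ` {1..s}" "verts H = (\<Union>i\<in>{1..s}. e i)"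
    and deg: "\<And>v. card {i \<in> {1..s}. v \<in> e i} \<le> 2" and t: "2 * t < s"
  shows "hfree H (star_graph t n)"
  unfolding hfree_def
proof
  assume "contains_copy (star_graph t n) H"
  then obtain f where f: "inj_on f (verts H)" "\<forall>h\<in>edges H. f ` h \<in> edges (star_graph t n)"
    by (auto simp: contains_copy_def)
  define S where "S = (\<lambda>a. {i \<in> {1..s}. a \<in> f ` e i})"
  have "card (S a) \<le> 2" for a
  proof (cases "\<exists>v\<in>verts H. a = f v")
    case True
    then obtain v where v: "v \<in> verts H" "a = f v" by auto
    have "S a \<subseteq> {i \<in> {1..s}. v \<in> e i}"
    proof
      fix i assume "i \<in> S a"
      then obtain w where w: "i \<in> {1..s}" "w \<in> e i" "f w = f v" using v by (auto simp: S_def)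
      then have "w \<in> verts H" using H(2) by blast
      then have "w = v" using f(1) v w by (meson inj_onD)
      then show "i \<in> {i \<in> {1..s}. v \<in> e i}" using w by simp
    qed
    then have "card (S a) \<le> card {i \<in> {1..s}. v \<in> e i}" by (intro card_mono) auto
    then show ?thesis using deg[of v] by simp
  next
    case False
    then have "S a = {}" using H(2) by (auto simp: S_def)
    then show ?thesis by simp
  qed
  then have "(\<Sum>a<t. card (S a)) \<le> 2 * t"
    using sum_bounded_above[of "{..<t}" "\<lambda>a. card (S a)" 2] by (simp add: mult.commute)
  moreover have "{1..s} \<subseteq> (\<Union>a<t. S a)"
  proof
    fix i assume i: "i \<in> {1..s}"
    then have "f ` e i \<in> edges (star_graph t n)" using f(2) H(1) by blast
    then obtain a where "a < t" "a \<in> f ` e i" by (auto simp: star_graph_def)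
    then show "i \<in> (\<Union>a<t. S a)" using i by (auto simp: S_def)
  qed
  then have "card {1..s} \<le> card (\<Union>a<t. S a)" by (intro card_mono) (auto simp: S_def)
  moreover have "card (\<Union>a<t. S a) \<le> (\<Sum>a<t. card (S a))" by (rule card_UN_le) simp
  ultimately show False using t by simp
qed

text \<open>Pairs with exactly one centre have the full codegree \<open>n - 2\<close> and already
  give the leading term; for fixed \<open>t\<close> all other pairs contribute only order
  \<open>n^2\<close>.\<close>

lemma co2_star_graph_ge:
  assumes "t \<le> n"
  shows "t * (n - t) * (n - 2)\<^sup>2 \<le> co2 (star_graph t n)"
proof -
  let ?G = "star_graph t n"
  have V: "verts ?G = {..<n}" by (simp add: star_graph_def)
  define F where "F = (\<lambda>(a, x). {a, x}) ` ({..<t} \<times> {t..<n})"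
  have FP: "F \<subseteq> {p. p \<subseteq> verts ?G \<and> card p = 2}"
    using assms by (auto simp: F_def V card_insert_if)
  have "inj_on (\<lambda>(a, x). {a, x}) ({..<t} \<times> {t..<n})"
    by (auto simp: inj_on_def doubleton_eq_iff)
  then have cF: "card F = t * (n - t)" unfolding F_def by (simp add: card_image)
  have cd: "codegree ?G p = n - 2" if p: "p \<in> F" for p
  proof -
    obtain a x where ax: "p = {a, x}" "a < t" "t \<le> x" "x < n" using p by (auto simp: F_def)
    have "conbrs ?G p = {..<n} - p"
      using ax assms by (auto simp: conbrs_def star_graph_def card_insert_if)
    moreover have "card p = 2" "p \<subseteq> {..<n}" using FP p by (auto simp: V)
    ultimately show ?thesis
      using codegree_eq[OF three_graph_star, of p t n] by (simp add: card_Diff_subset finite_subset)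
  qed
  have "t * (n - t) * (n - 2)\<^sup>2 = (\<Sum>p\<in>F. (codegree ?G p)\<^sup>2)" using cd cF by simp
  also have "\<dots> \<le> co2 ?G" unfolding co2_def
    using FP finite_pairs[of "verts ?G"] by (intro sum_mono2) (auto simp: pairs_def V)
  finally show ?thesis .
qed

text \<open>Crude, but it makes the set of values of \<open>co2\<close> finite, as
  \<open>Max\<close> in \<open>exco2\<close> requires.\<close>

lemma co2_le_trivial:
  assumes "three_graph G"
  shows "co2 G \<le> card (verts G) ^ 4"
proof -
  have fV: "finite (verts G)" using assms by (simp add: three_graph_def)
  have "(codegree G p)\<^sup>2 \<le> (card (verts G))\<^sup>2" if "p \<in> pairs (verts G)" for p
    using that codegree_eq[OF assms, of p] card_mono[OF fV conbrs_subset[OF assms, of p]]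
    by (intro power_mono) (auto simp: pairs_def)
  then have "co2 G \<le> card (pairs (verts G)) * (card (verts G))\<^sup>2"
    using sum_bounded_above[of "pairs (verts G)" "\<lambda>p. (codegree G p)\<^sup>2" "(card (verts G))\<^sup>2"]
    by (simp add: co2_def pairs_def)
  also have "\<dots> \<le> (card (verts G))\<^sup>2 * (card (verts G))\<^sup>2"
    by (intro mult_right_mono card_pairs_le[OF fV]) simp
  finally show ?thesis by (simp flip: power_add)
qed

lemma exco2_asymp_equiv:
  assumes t: "t \<ge> 1" and free: "\<And>n. hfree H (star_graph t n)"
    and ub: "\<And>G :: nat hypergraph. three_graph G \<Longrightarrow> hfree H G \<Longrightarrow>
      co2 G \<le> t * card (verts G) ^ 3 + D * (card (verts G))\<^sup>2"
  shows "(\<lambda>n. real (exco2 n H)) \<sim>[at_top] (\<lambda>n. real t * real n ^ 3)"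
proof -
  have fin: "finite {co2 G | G :: nat hypergraph. three_graph G \<and> card (verts G) = n \<and> hfree H G}" for n
    by (rule finite_subset[of _ "{..n ^ 4}"]) (auto simp: co2_le_trivial)
  have mem: "co2 (star_graph t n) \<in>
      {co2 G | G :: nat hypergraph. three_graph G \<and> card (verts G) = n \<and> hfree H G}" for n
    using three_graph_star[of t n] free[of n] by (auto simp: star_graph_def intro!: exI[of _ "star_graph t n"])
  \<comment> \<open>\<open>Max_le_iff\<close> also asks for a nonempty set; the star graph provides
    an element for every \<open>n\<close>.\<close>
  have up: "exco2 n H \<le> t * n ^ 3 + D * n\<^sup>2" for n
    unfolding exco2_def using mem[of n] ub by (subst Max_le_iff[OF fin]) blast+
  have low: "t * (n - t) * (n - 2)\<^sup>2 \<le> exco2 n H" if "t \<le> n" for n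
    unfolding exco2_def using co2_star_graph_ge[OF that] Max_ge[OF fin mem] by (rule order_trans)
  show ?thesis
  proof (rule asymp_equiv_sandwich_real)
    have "real t > 0" using t by simp
    then show "(\<lambda>n. real t * (real n - real t) * (real n - 2)\<^sup>2) \<sim>[at_top] (\<lambda>n. real t * real n ^ 3)"
      by real_asymp
    show "(\<lambda>n. real t * real n ^ 3 + real D * (real n)\<^sup>2) \<sim>[at_top] (\<lambda>n. real t * real n ^ 3)"
      using \<open>real t > 0\<close> by real_asymp
    show "\<forall>\<^sub>F n in at_top. real (exco2 n H) \<in>
        {real t * (real n - real t) * (real n - 2)\<^sup>2..real t * real n ^ 3 + real D * (real n)\<^sup>2}"
      \<comment> \<open>From \<open>t + 2\<close> on, both truncated subtractions in
        \<open>low\<close> agree with the real ones.\<close>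
      using eventually_ge_at_top[of "t + 2"]
    proof eventually_elim
      case (elim n)
      have "real (t * (n - t) * (n - 2)\<^sup>2) \<le> real (exco2 n H)"
        using low[of n] elim by (intro of_nat_mono) simp
      moreover have "real (t * (n - t) * (n - 2)\<^sup>2) = real t * (real n - real t) * (real n - 2)\<^sup>2"
        using elim by (simp add: of_nat_diff)
      moreover have "real (exco2 n H) \<le> real (t * n ^ 3 + D * n\<^sup>2)"
        using up[of n] by (simp only: of_nat_le_iff)
      ultimately show ?case unfolding atLeastAtMost_iff by (metis of_nat_add of_nat_mult of_nat_power)
    qed
  qed
qed

theorem theorem1p4:
  fixes s :: nat and C :: "'a hypergraph" and P :: "'b hypergraph"
  assumes "s \<ge> 4" and "loose_cycle s C" and "loose_path s P"
  shows "(\<lambda>n. real (exco2 n C)) \<sim>[at_top] (\<lambda>n. real_of_int \<lfloor>(real s - 1) / 2\<rfloor> * real n ^ 3) \<and>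
         (\<lambda>n. real (exco2 n P)) \<sim>[at_top] (\<lambda>n. real_of_int \<lfloor>(real s - 1) / 2\<rfloor> * real n ^ 3)"
proof -
  define t where "t = (s - 1) div 2"
  have t: "t \<ge> 1" "2 * t < s" using assms(1) by (auto simp: t_def)
  have "\<lfloor>(real s - 1) / 2\<rfloor> = \<lfloor>real (s - 1) / real 2\<rfloor>" using assms(1) by (simp add: of_nat_diff)
  also have "\<dots> = int t" unfolding t_def by (rule floor_divide_of_nat_eq)
  finally have fl: "real_of_int \<lfloor>(real s - 1) / 2\<rfloor> = real t" by simp
  obtain e where e: "loose_cycle_edges s e" "edges C = e ` {1..s}" "verts C = (\<Union>i\<in>{1..s}. e i)"
    using assms(2) by (auto simp: loose_cycle_def)
  obtain h where h: "loose_path_edges s h" "edges P = h ` {1..s}" "verts P = (\<Union>i\<in>{1..s}. h i)"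
    using assms(3) by (auto simp: loose_path_def)
  have "(\<lambda>n. real (exco2 n C)) \<sim>[at_top] (\<lambda>n. real t * real n ^ 3)"
    using star_graph_hfree[OF e(2,3) loose_cycle_edges_degree_le[OF e(1) assms(1)] t(2)]
      co2_cycle_free_le[OF assms(2,1)] unfolding t_def[symmetric]
    by (intro exco2_asymp_equiv[OF t(1)])
  moreover have "(\<lambda>n. real (exco2 n P)) \<sim>[at_top] (\<lambda>n. real t * real n ^ 3)"
    using star_graph_hfree[OF h(2,3) loose_path_edges_degree_le[OF h(1)] t(2)]
      co2_path_free_le[OF assms(3,1)] unfolding t_def[symmetric]
    by (intro exco2_asymp_equiv[OF t(1)])
  ultimately show ?thesis unfolding fl by simp
qed

end
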